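(* There is a universal constant $C>0$ such that for all integers $n,T,r\ge 1$ and every $L>0$ there is a learner's strategy for the $T$-round online learning problem for $n$-qubit states such that, for every (possibly adaptive) adversary choosing convex $L$-Lipschitz loss functions $\ell_t:\mathbb{R}\to\mathbb{R}$ and effects $E_t$ with $\operatorname{rank}(E_t)\le r$ for all $t\in\{1,\dots,T\}$, the regret satisfies \[ R_T\;\le\; C\,L\,\sqrt{\min\{r,n\}\,T}. \]
   Context: Let $\mathrm{D}_n$ be the set of $n$-qubit quantum states, i.e. $2^n\times 2^n$ complex positive semidefinite matrices of trace one. An effect is a $2^n\times 2^n$ Hermitian matrix $E$ with $0\preceq E\preceq \mathbb{1}$. Online protocol: in each round $t=1,\dots,T$ the learner outputs $\omega_t\in\mathrm{D}_n$ (as a function of the previously revealed $(E_s,\ell_s)_{s<t}$ and of the parameters $n,T,r,L$); then the adversary reveals an effect $E_t$ and a loss function $\ell_t$, and the learner incurs loss $\ell_t(\operatorname{tr}(E_t\omega_t))$. The regret is \[ R_T=\sum_{t=1}^T \ell_t\big(\operatorname{tr}(E_t\omega_t)\big)-\min_{\omega\in\mathrm{D}_n}\sum_{t=1}^T \ell_t\big(\operatorname{tr}(E_t\omega)\big), \] and the bound is required for every possible sequence of adversary choices. *)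

theory Defs
  imports
    "HOL-Analysis.Analysis"
    "Jordan_Normal_Form.Schur_Decomposition"
    "Jordan_Normal_Form.DL_Rank"
begin

text \<open>Matrices are those of \<^theory>\<open>Jordan_Normal_Form.Matrix\<close>, whose dimension is a
  term: the constant of the theorem is chosen before the number of qubits, which therefore has to be
  quantified inside the statement.\<close>

hide_const (open) Determinants.trace
hide_const (open) Finite_Cartesian_Product.vec Finite_Cartesian_Product.mat
hide_type (open) Finite_Cartesian_Product.vec

definition mtrace :: "complex mat \<Rightarrow> complex" where
  "mtrace A = (\<Sum>i<dim_row A. A $$ (i, i))"

definition hermitian_mat :: "nat \<Rightarrow> complex mat \<Rightarrow> bool" where
  "hermitian_mat d A \<longleftrightarrow> A \<in> carrier_mat d d \<and> mat_adjoint A = A"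

text \<open>The scalar product below is \<open>v\<^sup>* A v\<close>; in the order on complex numbers,
  \<open>0 \<le> z\<close> means that \<open>z\<close> is real and nonnegative.\<close>

definition psd_mat :: "nat \<Rightarrow> complex mat \<Rightarrow> bool" where
  "psd_mat d A \<longleftrightarrow> hermitian_mat d A \<and> (\<forall>v \<in> carrier_vec d. 0 \<le> (A *\<^sub>v v) \<bullet>c v)"

definition qstates :: "nat \<Rightarrow> complex mat set" where
  "qstates n = {\<omega>. psd_mat (2 ^ n) \<omega> \<and> mtrace \<omega> = 1}"

definition effects :: "nat \<Rightarrow> complex mat set" where
  "effects n = {E. hermitian_mat (2 ^ n) E \<and> psd_mat (2 ^ n) E \<and> psd_mat (2 ^ n) (1\<^sub>m (2 ^ n) - E)}"

definition mat_rank :: "nat \<Rightarrow> complex mat \<Rightarrow> nat" where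
  "mat_rank d A = vec_space.rank d A"

text \<open>The trace of the product of two Hermitian matrices is real, so taking the real part only
  changes the type.\<close>

definition outcome :: "complex mat \<Rightarrow> complex mat \<Rightarrow> real" where
  "outcome E \<omega> = Re (mtrace (E * \<omega>))"

text \<open>A move of the adversary is an effect with a loss function. A learner maps the earlier moves of
  the adversary, oldest first, to a state; an adversary, which may be adaptive, maps the earlier
  rounds and the learner's present state to its next move. The parameters \<open>n\<close>, \<open>T\<close>,
  \<open>r\<close>, \<open>L\<close> are not arguments, as a strategy is chosen after they are fixed.\<close>

type_synonym move = "complex mat \<times> (real \<Rightarrow> real)"
type_synonym round = "complex mat \<times> move"
type_synonym learner = "move list \<Rightarrow> complex mat"
type_synonym adversary = "round list \<Rightarrow> complex mat \<Rightarrow> move"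

definition is_learner :: "nat \<Rightarrow> learner \<Rightarrow> bool" where
  "is_learner n S \<longleftrightarrow> (\<forall>h. S h \<in> qstates n)"

primrec play :: "learner \<Rightarrow> adversary \<Rightarrow> nat \<Rightarrow> round list" where
  "play S A 0 = []"
| "play S A (Suc t) =
    (let h = play S A t; \<omega> = S (map snd h) in h @ [(\<omega>, A h \<omega>)])"

definition admissible_move :: "nat \<Rightarrow> nat \<Rightarrow> real \<Rightarrow> move \<Rightarrow> bool" where
  "admissible_move n r L m \<longleftrightarrow> (case m of (E, l) \<Rightarrow>
    E \<in> effects n \<and> mat_rank (2 ^ n) E \<le> r \<and> convex_on UNIV l \<and> L-lipschitz_on UNIV l)"

text \<open>For continuous losses the infimum is a minimum, since the set of states is compact and
  nonempty.\<close>

definition regret :: "nat \<Rightarrow> round list \<Rightarrow> real" where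
  "regret n h =
    (\<Sum>(\<omega>, E, l)\<leftarrow>h. l (outcome E \<omega>))
    - (INF \<omega> \<in> qstates n. \<Sum>(_, E, l)\<leftarrow>h. l (outcome E \<omega>))"

end

theory Submission
  imports Defs
begin

text \<open>By convexity each loss may be replaced by its tangent at the learner's outcome, so that the learner
  faces linear losses \<open>g\<^sub>t tr(E\<^sub>t \<omega>)\<close> with \<open>\<bar>g\<^sub>t\<bar> \<le> L\<close>. Let \<open>X\<close> be
  \<open>- \<eta>\<close> times the sum of the \<open>g\<^sub>s E\<^sub>s\<close> seen so far. The learner plays the gradient at \<open>X\<close> of a
  smooth potential that dominates \<open>tr(X \<omega>)\<close> on states.

  For \<open>r \<le> n\<close> the potential is the conjugate of half the squared Frobenius norm, the play is the
  projection of \<open>X\<close> onto the states, and the second order term is controlled by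
  \<open>tr(E\<^sup>2) \<le> rank E \<le> r\<close>. For \<open>n < r\<close>, \<open>n \<le> T\<close> it is \<open>ln (tr (exp X))\<close>, which starts at
  \<open>n ln 2\<close>, and the play is the Gibbs state. Golden-Thompson is avoided: expanding
  \<open>tr (exp Y) - tr (exp X) - tr ((Y - X) exp X)\<close> over the eigenbases of \<open>X\<close> and \<open>Y\<close> reduces the second
  order bound to a scalar inequality for the exponential. For \<open>T < n\<close> the bound \<open>L T\<close> is enough.\<close>

section \<open>Orthonormal bases and the spectral theorem\<close>

text \<open>Vectors and matrices are functions on all naturals of which only the values below
  \<open>d\<close> matter. This avoids carrier conditions on intermediate objects; in return,
  equality of matrices is asserted entrywise below \<open>d\<close>, and congruence rules such as
  \<open>dotc_cong\<close> transport it.\<close>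

definition dotc :: "nat \<Rightarrow> (nat \<Rightarrow> complex) \<Rightarrow> (nat \<Rightarrow> complex) \<Rightarrow> complex" where
  "dotc d x y = (\<Sum>k<d. x k * cnj (y k))"

definition matvec :: "nat \<Rightarrow> (nat \<Rightarrow> nat \<Rightarrow> complex) \<Rightarrow> (nat \<Rightarrow> complex) \<Rightarrow> nat \<Rightarrow> complex" where
  "matvec d A x = (\<lambda>k. \<Sum>l<d. A k l * x l)"

definition herm :: "nat \<Rightarrow> (nat \<Rightarrow> nat \<Rightarrow> complex) \<Rightarrow> bool" where
  "herm d A \<longleftrightarrow> (\<forall>k<d. \<forall>l<d. cnj (A k l) = A l k)"

definition qform :: "nat \<Rightarrow> (nat \<Rightarrow> nat \<Rightarrow> complex) \<Rightarrow> (nat \<Rightarrow> complex) \<Rightarrow> real" where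
  "qform d A x = Re (dotc d (matvec d A x) x)"

text \<open>The real Hilbert-Schmidt inner product. For Hermitian arguments it is the trace of the
  product, so it expresses both the outcome of a measurement and the Frobenius geometry.\<close>

definition frob :: "nat \<Rightarrow> (nat \<Rightarrow> nat \<Rightarrow> complex) \<Rightarrow> (nat \<Rightarrow> nat \<Rightarrow> complex) \<Rightarrow> real" where
  "frob d A B = (\<Sum>k<d. \<Sum>l<d. Re (A k l * cnj (B k l)))"

definition orthon :: "nat \<Rightarrow> nat \<Rightarrow> (nat \<Rightarrow> nat \<Rightarrow> complex) \<Rightarrow> bool" where
  "orthon d m u \<longleftrightarrow> (\<forall>i<m. \<forall>j<m. dotc d (u i) (u j) = of_bool (i = j))"

text \<open>For orthonormal \<open>u\<close> this is the matrix with eigenvalues \<open>a\<close>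
  and eigenvectors \<open>u\<close>. Applying a function to \<open>a\<close> alone yields the
  corresponding matrix function, so matrix exponentials need no definition of their own.\<close>

definition eigmat :: "nat \<Rightarrow> (nat \<Rightarrow> real) \<Rightarrow> (nat \<Rightarrow> nat \<Rightarrow> complex) \<Rightarrow> nat \<Rightarrow> nat \<Rightarrow> complex" where
  "eigmat d a u = (\<lambda>k l. \<Sum>i<d. of_real (a i) * u i k * cnj (u i l))"

lemma cnj_dotc: "cnj (dotc d x y) = dotc d y x"
  by (simp add: dotc_def mult.commute)

lemma dotc_self: "dotc d x x = of_real (\<Sum>k<d. (cmod (x k))\<^sup>2)"
  by (simp only: dotc_def of_real_sum complex_norm_square)

lemma dotc_scale_left: "dotc d (\<lambda>k. c * x k) y = c * dotc d x y"
  by (simp add: dotc_def sum_distrib_left mult.assoc)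

lemma dotc_scale_right: "dotc d x (\<lambda>k. c * y k) = cnj c * dotc d x y"
  by (simp add: dotc_def sum_distrib_left mult_ac)

lemma dotc_diff_left: "dotc d (\<lambda>k. x k - y k) z = dotc d x z - dotc d y z"
  by (simp add: dotc_def sum_subtractf algebra_simps)

lemma dotc_sum_left: "dotc d (\<lambda>k. \<Sum>i\<in>I. x i k) y = (\<Sum>i\<in>I. dotc d (x i) y)"
  unfolding dotc_def by (subst sum.swap) (simp add: sum_distrib_right)

lemma dotc_cong: "(\<And>k. k < d \<Longrightarrow> x k = x' k) \<Longrightarrow> (\<And>k. k < d \<Longrightarrow> y k = y' k) \<Longrightarrow> dotc d x y = dotc d x' y'"
  by (simp add: dotc_def)

lemma hermD: "herm d A \<Longrightarrow> k < d \<Longrightarrow> l < d \<Longrightarrow> cnj (A k l) = A l k"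
  by (simp add: herm_def)

lemma herm_dotc_matvec:
  assumes "herm d A"
  shows "dotc d (matvec d A x) y = dotc d x (matvec d A y)"
proof -
  have "dotc d (matvec d A x) y = (\<Sum>k<d. \<Sum>l<d. A k l * x l * cnj (y k))"
    by (simp add: dotc_def matvec_def sum_distrib_right)
  also have "\<dots> = (\<Sum>l<d. \<Sum>k<d. A k l * x l * cnj (y k))" by (rule sum.swap)
  also have "\<dots> = (\<Sum>l<d. \<Sum>k<d. x l * cnj (A l k * y k))"
    using assms by (intro sum.cong refl) (simp add: hermD[of d A] mult_ac)
  also have "\<dots> = dotc d x (matvec d A y)"
    by (simp add: dotc_def matvec_def sum_distrib_left)
  finally show ?thesis .
qed

section \<open>Orthonormal systems, completeness and Parseval's identity\<close>

lemma orthonD: "orthon d m u \<Longrightarrow> i < m \<Longrightarrow> j < m \<Longrightarrow> dotc d (u i) (u j) = of_bool (i = j)"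
  by (simp add: orthon_def)

lemma normalize_dotc:
  assumes "k < d" "x k \<noteq> 0"
  shows "\<exists>c. c \<noteq> 0 \<and> dotc d (\<lambda>k. c * x k) (\<lambda>k. c * x k) = 1"
proof -
  define s where "s = (\<Sum>k<d. (cmod (x k))\<^sup>2)"
  have "s > 0" unfolding s_def using assms
    by (intro sum_pos2[of _ k]) auto
  then have "complex_of_real (1 / sqrt s) * complex_of_real (1 / sqrt s) * complex_of_real s = 1"
    unfolding of_real_mult[symmetric] by (simp flip: real_sqrt_mult)
  with \<open>s > 0\<close> show ?thesis
    by (intro exI[of _ "complex_of_real (1 / sqrt s)"])
       (simp only: dotc_scale_left dotc_scale_right dotc_self complex_cnj_complex_of_real s_def [symmetric] mult.assoc, simp)
qed

text \<open>The conjugated vectors \<open>u i\<close> are the first \<open>m\<close> rows of a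
  square matrix padded with zero rows. Since \<open>m < d\<close> there is a zero row, so the
  determinant vanishes and the kernel contains a nonzero vector.\<close>

lemma exists_orthogonal_vector:
  assumes "m < d"
  shows "\<exists>x k. k < d \<and> x k \<noteq> 0 \<and> (\<forall>i<m. dotc d x (u i) = 0)"
proof -
  define M where "M = mat d d (\<lambda>(i, k). if i < m then cnj (u i k) else 0)"
  have M: "M \<in> carrier_mat d d" by (simp add: M_def)
  have "row M m = 0\<^sub>v d" using assms by (auto simp: M_def)
  have "det M = 0"
  proof -
    have "det M = (\<Sum>j<d. M $$ (m, j) * cofactor M m j)"
      using laplace_expansion_row[OF M assms] .
    also have "\<dots> = 0" using assms by (intro sum.neutral) (auto simp: M_def)
    finally show ?thesis .
  qed
  then obtain v where v: "v \<in> carrier_vec d" "v \<noteq> 0\<^sub>v d" "M *\<^sub>v v = 0\<^sub>v d"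
    using det_0_iff_vec_prod_zero_field[OF M] by blast
  then obtain k where k: "k < d" "v $ k \<noteq> 0"
    by (metis carrier_vecD eq_vecI index_zero_vec)
  have "dotc d (\<lambda>k. v $ k) (u i) = 0" if "i < m" for i
  proof -
    have "(M *\<^sub>v v) $ i = 0" using v(3) that assms by simp
    then show ?thesis using v(1) that assms
      by (auto simp: M_def scalar_prod_def dotc_def mult.commute atLeast0LessThan)
  qed
  with k show ?thesis by blast
qed

lemma orthon_extend:
  assumes "orthon d m u" "m \<le> d"
  shows "\<exists>w. orthon d d w \<and> (\<forall>i<m. w i = u i)"
proof -
  have "m + t \<le> d \<Longrightarrow> \<exists>w. orthon d (m + t) w \<and> (\<forall>i<m. w i = u i)" for t
  proof (induction t)
    case 0
    then show ?case using assms(1) by auto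
  next
    case (Suc t)
    then obtain w where w: "orthon d (m + t) w" "\<forall>i<m. w i = u i" by auto
    obtain x k where x: "k < d" "x k \<noteq> 0" "\<forall>i<m+t. dotc d x (w i) = 0"
      using exists_orthogonal_vector[of "m + t" d w] Suc.prems by auto
    obtain c where c: "dotc d (\<lambda>k. c * x k) (\<lambda>k. c * x k) = 1"
      using normalize_dotc[of k d x] x by auto
    have 1: "dotc d (\<lambda>k. c * x k) (w i) = 0" if "i < m + t" for i
      using x(3) that by (simp add: dotc_scale_left)
    have 2: "dotc d (w i) (\<lambda>k. c * x k) = 0" if "i < m + t" for i
      using 1[OF that] by (metis cnj_dotc complex_cnj_zero)
    have "orthon d (m + Suc t) (w(m + t := (\<lambda>k. c * x k)))"
      using w(1) 1 2 c by (auto simp: orthon_def less_Suc_eq)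
    moreover have "\<forall>i<m. (w(m + t := (\<lambda>k. c * x k))) i = u i" using w(2) by simp
    ultimately show ?case by blast
  qed
  from this[of "d - m"] assms(2) show ?thesis by simp
qed

text \<open>Orthonormality says that the square matrix \<open>U\<close> with rows \<open>u i\<close>
  has its adjoint as right inverse; a right inverse of a square matrix is also a left inverse, which
  is the completeness relation.\<close>

lemma orthon_complete:
  assumes "orthon d d u" "k < d" "l < d"
  shows "(\<Sum>i<d. u i k * cnj (u i l)) = of_bool (k = l)"
proof -
  define U where "U = mat d d (\<lambda>(i, k). u i k)"
  define V where "V = mat d d (\<lambda>(k, i). cnj (u i k))"
  have "U * V = 1\<^sub>m d"
  proof (rule eq_matI)
    fix i j assume "i < dim_row (1\<^sub>m d :: complex mat)" "j < dim_col (1\<^sub>m d :: complex mat)"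
    then show "(U * V) $$ (i, j) = 1\<^sub>m d $$ (i, j)"
      using assms(1) by (auto simp: U_def V_def scalar_prod_def orthon_def dotc_def atLeast0LessThan)
  qed (auto simp: U_def V_def)
  then have "V * U = 1\<^sub>m d"
    by (intro mat_mult_left_right_inverse[of U d V]) (auto simp: U_def V_def)
  then have "(V * U) $$ (l, k) = of_bool (k = l)" using assms by simp
  then show ?thesis using assms
    by (simp add: U_def V_def scalar_prod_def atLeast0LessThan mult.commute)
qed

lemma orthon_expand:
  assumes "orthon d d u" "k < d"
  shows "x k = (\<Sum>i<d. dotc d x (u i) * u i k)"
proof -
  have "(\<Sum>i<d. dotc d x (u i) * u i k) = (\<Sum>i<d. \<Sum>l<d. x l * (u i k * cnj (u i l)))"
    by (simp add: dotc_def sum_distrib_right sum_distrib_left mult_ac)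
  also have "\<dots> = (\<Sum>l<d. x l * (\<Sum>i<d. u i k * cnj (u i l)))"
    by (subst sum.swap) (simp add: sum_distrib_left)
  also have "\<dots> = (\<Sum>l<d. x l * of_bool (k = l))"
    using assms by (intro sum.cong refl) (simp add: orthon_complete)
  also have "\<dots> = x k" using assms(2) by (simp add: of_bool_def if_distrib sum.delta cong: if_cong)
  finally show ?thesis by simp
qed

lemma parseval:
  assumes "orthon d d u"
  shows "(\<Sum>i<d. (cmod (dotc d x (u i)))\<^sup>2) = (\<Sum>k<d. (cmod (x k))\<^sup>2)"
proof -
  have "complex_of_real (\<Sum>k<d. (cmod (x k))\<^sup>2) = dotc d x x" by (simp only: dotc_self)
  also have "\<dots> = dotc d (\<lambda>k. \<Sum>i<d. dotc d x (u i) * u i k) x"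
    by (rule dotc_cong) (use orthon_expand[OF assms] in auto)
  also have "\<dots> = (\<Sum>i<d. dotc d x (u i) * cnj (dotc d x (u i)))"
    by (simp add: dotc_sum_left dotc_scale_left cnj_dotc)
  also have "\<dots> = complex_of_real (\<Sum>i<d. (cmod (dotc d x (u i)))\<^sup>2)"
    by (simp only: of_real_sum complex_norm_square)
  finally show ?thesis by (simp only: of_real_eq_iff)
qed

lemma matvec_sum: "matvec d A (\<lambda>l. \<Sum>i\<in>I. c i * x i l) k = (\<Sum>i\<in>I. c i * matvec d A (x i) k)"
proof -
  have "matvec d A (\<lambda>l. \<Sum>i\<in>I. c i * x i l) k = (\<Sum>l<d. \<Sum>i\<in>I. c i * (A k l * x i l))"
    by (simp add: matvec_def sum_distrib_left mult_ac)
  also have "\<dots> = (\<Sum>i\<in>I. c i * matvec d A (x i) k)"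
    by (subst sum.swap) (simp add: matvec_def sum_distrib_left)
  finally show ?thesis .
qed

section \<open>Existence of an orthonormal eigenbasis\<close>

text \<open>Over the complex numbers the characteristic polynomial splits into \<open>n\<close>
  linear factors, so for \<open>n > 0\<close> it has a root.\<close>

lemma complex_eigenvector:
  fixes n :: nat
  assumes "n > 0"
  obtains y e where "\<exists>i<n. y i \<noteq> 0" "\<forall>i<n. (\<Sum>j<n. B i j * y j) = (e::complex) * y i"
proof -
  define M where "M = mat n n (\<lambda>(i, j). B i j)"
  have M: "M \<in> carrier_mat n n" by (simp add: M_def)
  obtain as where as: "char_poly M = (\<Prod>a\<leftarrow>as. [:- a, 1:])" "length as = n"
    using char_poly_factorized[OF M] by blast
  with assms obtain e as' where "as = e # as'" by (cases as) auto
  with as have "poly (char_poly M) e = 0" by simp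
  then have "eigenvalue M e" using eigenvalue_root_char_poly[OF M] by blast
  then obtain v where v: "v \<in> carrier_vec n" "v \<noteq> 0\<^sub>v n" "M *\<^sub>v v = e \<cdot>\<^sub>v v"
    using M by (auto simp: eigenvalue_def eigenvector_def)
  then have "\<exists>i<n. v $ i \<noteq> 0"
    by (metis carrier_vecD eq_vecI index_zero_vec)
  moreover have "(\<Sum>j<n. B i j * v $ j) = e * v $ i" if "i < n" for i
  proof -
    have "(M *\<^sub>v v) $ i = (e \<cdot>\<^sub>v v) $ i" using v(3) by simp
    then show ?thesis using that v(1)
      by (auto simp: M_def scalar_prod_def atLeast0LessThan)
  qed
  ultimately show ?thesis using that[of "\<lambda>i. v $ i" e] by blast
qed

lemma herm_eigenvalue_real:
  assumes "herm d A" "dotc d v v = 1" "\<forall>k<d. matvec d A v k = e * v k"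
  shows "of_real (Re e) = e"
proof -
  have 1: "dotc d (matvec d A v) v = e"
    using assms dotc_cong[of d "matvec d A v" "\<lambda>k. e * v k" v v] by (simp add: dotc_scale_left)
  have 2: "dotc d v (matvec d A v) = cnj e"
    using assms dotc_cong[of d v v "matvec d A v" "\<lambda>k. e * v k"] by (simp add: dotc_scale_right)
  have "cnj e = e" using 1 2 herm_dotc_matvec[OF assms(1)] by metis
  then have "e \<in> \<real>" by (simp only: Reals_cnj_iff)
  then show ?thesis by simp
qed

text \<open>Induction on the number of eigenvectors already found. A Hermitian matrix leaves the
  orthogonal complement of its eigenvectors invariant, so an eigenvector of the compression to that
  complement is an eigenvector of \<open>A\<close> itself.\<close>

lemma herm_orthonormal_eigenvectors:
  assumes "herm d A" "m \<le> d"
  shows "\<exists>u a. orthon d m u \<and> (\<forall>i<m. \<forall>k<d. matvec d A (u i) k = of_real (a i) * u i k)"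
  using assms(2)
proof (induction m)
  case 0
  then show ?case by (auto simp: orthon_def)
next
  case (Suc m)
  then obtain u a where u: "orthon d m u" "\<forall>i<m. \<forall>k<d. matvec d A (u i) k = complex_of_real (a i) * u i k"
    by auto
  obtain w where w: "orthon d d w" "\<forall>i<m. w i = u i"
    using orthon_extend[OF u(1)] Suc.prems by auto
  define n where "n = d - m"
  have n: "n > 0" "m + n = d" using Suc.prems by (auto simp: n_def)
  \<comment> \<open>The matrix is the compression of \<open>A\<close> to the span of
    \<open>w m\<close>, ..., \<open>w (d - 1)\<close>, written in that basis; \<open>y\<close> holds
    the coordinates of the eigenvector \<open>x\<close> defined below.\<close>
  obtain y e where ex: "\<exists>i<n. y i \<noteq> 0"
    and y: "\<forall>i<n. (\<Sum>j<n. dotc d (matvec d A (w (m + j))) (w (m + i)) * y j) = e * y i"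
    by (rule complex_eigenvector[OF n(1)])
  then obtain i0 where i0: "i0 < n" "y i0 \<noteq> 0" by blast
  define x where "x = (\<lambda>k. \<Sum>j<n. y j * w (m + j) k)"
  have xw: "dotc d x (w i) = (\<Sum>j<n. y j * of_bool (m + j = i))" if "i < d" for i
    unfolding x_def dotc_sum_left dotc_scale_left
    using w(1) that n by (intro sum.cong refl) (auto simp: orthon_def)
  have xw1: "dotc d x (w i) = 0" if "i < m" for i
  proof -
    have "i < d" using that n by simp
    show ?thesis using that unfolding xw[OF \<open>i < d\<close>] by (auto intro!: sum.neutral)
  qed
  have xw2: "dotc d x (w (m + i)) = y i" if "i < n" for i
  proof -
    have "m + i < d" using that n by simp
    show ?thesis unfolding xw[OF \<open>m + i < d\<close>] using that
      by (simp add: of_bool_def if_distrib sum.delta cong: if_cong)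
  qed
  have ev: "matvec d A x k = e * x k" if k: "k < d" for k
  proof -
    \<comment> \<open>The equation \<open>A x = e x\<close> is checked coordinate by coordinate in
      the basis \<open>w\<close>. On old eigenvectors both sides vanish, because \<open>A\<close>
      can be moved to the other argument; on the remaining vectors it is the eigenvalue equation of
      the compression.\<close>
    have *: "dotc d (matvec d A x) (w i) = e * dotc d x (w i)" if "i < d" for i
    proof (cases "i < m")
      case True
      have "dotc d (matvec d A x) (w i) = dotc d x (matvec d A (w i))"
        by (rule herm_dotc_matvec[OF assms(1)])
      also have "\<dots> = dotc d x (\<lambda>k. of_real (a i) * w i k)"
        by (rule dotc_cong) (use u w True in auto)
      also have "\<dots> = 0" using True xw1 by (simp add: dotc_scale_right)
      finally show ?thesis using True xw1 by simp
    next
      case False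
      define j where "j = i - m"
      have j: "i = m + j" "j < n" using that n False by (auto simp: j_def)
      have "dotc d (matvec d A x) (w i) = dotc d (\<lambda>k. \<Sum>j<n. y j * matvec d A (w (m + j)) k) (w i)"
        by (rule dotc_cong) (auto simp: x_def matvec_sum)
      also have "\<dots> = (\<Sum>l<n. dotc d (matvec d A (w (m + l))) (w (m + j)) * y l)"
        by (simp add: dotc_sum_left dotc_scale_left j mult.commute)
      also have "\<dots> = e * y j" using y j by blast
      finally show ?thesis using j xw2 by simp
    qed
    have "matvec d A x k = (\<Sum>i<d. dotc d (matvec d A x) (w i) * w i k)"
      by (rule orthon_expand[OF w(1) k])
    also have "\<dots> = e * (\<Sum>i<d. dotc d x (w i) * w i k)"
      using * by (simp add: sum_distrib_left mult.assoc)
    also have "\<dots> = e * x k" by (simp only: orthon_expand[OF w(1) k, of x, symmetric])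
    finally show ?thesis .
  qed
  have "\<exists>k<d. x k \<noteq> 0"
  proof (rule ccontr)
    assume "\<not> ?thesis"
    then have "dotc d x (w (m + i0)) = 0" by (simp add: dotc_def)
    with xw2 i0 show False by simp
  qed
  then obtain c where c: "dotc d (\<lambda>k. c * x k) (\<lambda>k. c * x k) = 1"
    using normalize_dotc[of _ d x] by auto
  define v where "v = (\<lambda>k. c * x k)"
  have vA: "matvec d A v k = e * v k" if "k < d" for k
  proof -
    have "matvec d A v k = c * matvec d A x k"
      by (simp add: v_def matvec_def sum_distrib_left mult_ac)
    then show ?thesis using ev[OF that] by (simp add: v_def mult_ac)
  qed
  have e: "of_real (Re e) = e"
    by (rule herm_eigenvalue_real[OF assms(1), of v]) (use c vA v_def in auto)
  have vA': "matvec d A v k = of_real (Re e) * v k" if "k < d" for k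
    by (simp only: e vA[OF that])
  have 1: "dotc d v (u i) = 0" if "i < m" for i
    using xw1[OF that] w(2) that by (simp add: v_def dotc_scale_left)
  have 2: "dotc d (u i) v = 0" if "i < m" for i
    using 1[OF that] by (metis cnj_dotc complex_cnj_zero)
  have "orthon d (Suc m) (u(m := v))"
    using u(1) 1 2 c by (auto simp: orthon_def less_Suc_eq v_def)
  moreover have "\<forall>i<Suc m. \<forall>k<d. matvec d A ((u(m := v)) i) k = of_real ((a(m := Re e)) i) * (u(m := v)) i k"
    using u(2) vA' by (auto simp: less_Suc_eq)
  ultimately have "orthon d (Suc m) (u(m := v)) \<and> (\<forall>i<Suc m. \<forall>k<d. matvec d A ((u(m := v)) i) k = of_real ((a(m := Re e)) i) * (u(m := v)) i k)" ..
  then show ?case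
    by (rule exI[of _ "u(m := v)", OF exI[of _ "a(m := Re e)"]])
qed

lemma spectral_theorem:
  assumes "herm d A"
  obtains u a where "orthon d d u" "\<And>k l. k < d \<Longrightarrow> l < d \<Longrightarrow> A k l = eigmat d a u k l"
proof -
  obtain u a where u: "orthon d d u" "\<forall>i<d. \<forall>k<d. matvec d A (u i) k = complex_of_real (a i) * u i k"
    using herm_orthonormal_eigenvectors[OF assms order_refl] by blast
  have "A k l = eigmat d a u k l" if "k < d" "l < d" for k l
  proof -
    have "A k l = (\<Sum>l'<d. A k l' * of_bool (l' = l))"
      using that by (simp add: of_bool_def if_distrib sum.delta cong: if_cong)
    also have "\<dots> = (\<Sum>l'<d. A k l' * (\<Sum>i<d. u i l' * cnj (u i l)))"
      using that orthon_complete[OF u(1)] by (intro sum.cong refl) auto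
    also have "\<dots> = (\<Sum>l'<d. \<Sum>i<d. A k l' * u i l' * cnj (u i l))"
      by (simp add: sum_distrib_left mult.assoc)
    also have "\<dots> = (\<Sum>i<d. matvec d A (u i) k * cnj (u i l))"
      by (subst sum.swap) (simp add: matvec_def sum_distrib_right)
    also have "\<dots> = eigmat d a u k l" using u(2) that by (simp add: eigmat_def)
    finally show ?thesis .
  qed
  with u(1) show ?thesis by (rule that)
qed

section \<open>Functions of Hermitian matrices\<close>

text \<open>Taking real parts in the trace loses nothing, as the diagonal of a Hermitian matrix is
  real.\<close>

definition density_op :: "nat \<Rightarrow> (nat \<Rightarrow> nat \<Rightarrow> complex) \<Rightarrow> bool" where
  "density_op d W \<longleftrightarrow> herm d W \<and> (\<forall>x. 0 \<le> qform d W x) \<and> (\<Sum>k<d. Re (W k k)) = 1"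

section \<open>Pairings and quadratic forms of spectral decompositions\<close>

lemma frob_cong:
  "(\<And>k l. k < d \<Longrightarrow> l < d \<Longrightarrow> A k l = A' k l) \<Longrightarrow> (\<And>k l. k < d \<Longrightarrow> l < d \<Longrightarrow> B k l = B' k l)
    \<Longrightarrow> frob d A B = frob d A' B'"
  by (simp add: frob_def)

lemma frob_commute: "frob d A B = frob d B A"
  by (simp add: frob_def mult.commute)

lemma frob_add_left: "frob d (\<lambda>k l. A k l + of_real s * B k l) C = frob d A C + s * frob d B C"
  by (simp add: frob_def sum.distrib sum_distrib_left algebra_simps)

lemma frob_self: "frob d A A = (\<Sum>k<d. \<Sum>l<d. (cmod (A k l))\<^sup>2)"
  by (simp only: frob_def complex_norm_square[symmetric] Re_complex_of_real)

text \<open>By linearity it is enough that pairing \<open>M\<close> with the rank-one matrix built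
  from \<open>u i\<close> gives the quadratic form of \<open>M\<close> at \<open>u i\<close>. All
  pairings with spectral functions are evaluated through this identity.\<close>

lemma frob_eigmat: "frob d M (eigmat d p u) = (\<Sum>i<d. p i * qform d M (u i))"
proof -
  have "frob d M (eigmat d p u) = Re (\<Sum>k<d. \<Sum>l<d. \<Sum>i<d. of_real (p i) * (M k l * u i l * cnj (u i k)))"
    by (simp add: frob_def eigmat_def sum_distrib_left mult_ac)
  also have "(\<Sum>k<d. \<Sum>l<d. \<Sum>i<d. of_real (p i) * (M k l * u i l * cnj (u i k)))
      = (\<Sum>k<d. \<Sum>i<d. \<Sum>l<d. of_real (p i) * (M k l * u i l * cnj (u i k)))"
    by (intro sum.cong refl sum.swap)
  also have "\<dots> = (\<Sum>i<d. \<Sum>k<d. \<Sum>l<d. of_real (p i) * (M k l * u i l * cnj (u i k)))"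
    by (rule sum.swap)
  also have "\<dots> = (\<Sum>i<d. of_real (p i) * dotc d (matvec d M (u i)) (u i))"
    by (simp only: dotc_def matvec_def sum_distrib_left sum_distrib_right)
  finally show ?thesis by (simp add: qform_def)
qed

lemma matvec_eigmat: "matvec d (eigmat d a u) x k = (\<Sum>i<d. of_real (a i) * dotc d x (u i) * u i k)"
proof -
  have "matvec d (eigmat d a u) x k = (\<Sum>l<d. \<Sum>i<d. of_real (a i) * (x l * cnj (u i l)) * u i k)"
    by (simp add: matvec_def eigmat_def sum_distrib_right sum_distrib_left mult_ac)
  also have "\<dots> = (\<Sum>i<d. \<Sum>l<d. of_real (a i) * (x l * cnj (u i l)) * u i k)"
    by (rule sum.swap)
  finally show ?thesis by (simp only: dotc_def sum_distrib_left sum_distrib_right)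
qed

lemma cmod_dotc_commute: "cmod (dotc d x y) = cmod (dotc d y x)"
  by (metis cnj_dotc complex_mod_cnj)

lemma dotc_matvec_eigmat:
  assumes "orthon d d u" "j < d"
  shows "dotc d (matvec d (eigmat d a u) x) (u j) = of_real (a j) * dotc d x (u j)"
proof -
  have "dotc d (matvec d (eigmat d a u) x) (u j) = (\<Sum>i<d. of_real (a i) * dotc d x (u i) * dotc d (u i) (u j))"
    by (simp add: matvec_eigmat[abs_def] dotc_sum_left dotc_scale_left)
  also have "\<dots> = (\<Sum>i<d. of_real (a i) * dotc d x (u i) * of_bool (i = j))"
    using assms by (intro sum.cong refl) (simp add: orthonD)
  finally show ?thesis using assms(2)
    by (simp add: of_bool_def if_distrib sum.delta cong: if_cong)
qed

lemma matvec_eigmat_eigenvector: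
  assumes "orthon d d u" "j < d"
  shows "matvec d (eigmat d a u) (u j) = (\<lambda>k. of_real (a j) * u j k)"
proof
  fix k
  have "matvec d (eigmat d a u) (u j) k = (\<Sum>i<d. of_real (a i) * of_bool (j = i) * u i k)"
    unfolding matvec_eigmat using assms by (intro sum.cong refl) (simp add: orthonD)
  also have "\<dots> = (\<Sum>i<d. if j = i then of_real (a i) * u i k else 0)"
    by (intro sum.cong refl) simp
  finally show "matvec d (eigmat d a u) (u j) k = of_real (a j) * u j k"
    using assms(2) by simp
qed

lemma qform_eigmat: "qform d (eigmat d a u) x = (\<Sum>i<d. a i * (cmod (dotc d x (u i)))\<^sup>2)"
proof -
  have "dotc d (matvec d (eigmat d a u) x) x = (\<Sum>i<d. of_real (a i) * (dotc d x (u i) * cnj (dotc d x (u i))))"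
    by (simp add: matvec_eigmat[abs_def] dotc_sum_left dotc_scale_left cnj_dotc mult.assoc)
  also have "\<dots> = of_real (\<Sum>i<d. a i * (cmod (dotc d x (u i)))\<^sup>2)"
    by (simp only: of_real_sum of_real_mult complex_norm_square)
  finally show ?thesis by (simp only: qform_def Re_complex_of_real)
qed

lemma orthon_norm: "orthon d m u \<Longrightarrow> i < m \<Longrightarrow> (\<Sum>k<d. (cmod (u i k))\<^sup>2) = 1"
proof -
  assume "orthon d m u" "i < m"
  then have "complex_of_real (\<Sum>k<d. (cmod (u i k))\<^sup>2) = 1"
    by (simp only: dotc_self[symmetric]) (simp add: orthonD)
  then show ?thesis by (simp only: of_real_eq_1_iff)
qed

lemma qform_eigmat_eigenvector:
  assumes "orthon d d u" "j < d"
  shows "qform d (eigmat d a u) (u j) = a j"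
  unfolding qform_def using assms
  by (simp add: matvec_eigmat_eigenvector dotc_scale_left orthonD)

lemma qform_cong: "(\<And>k l. k < d \<Longrightarrow> l < d \<Longrightarrow> A k l = B k l) \<Longrightarrow> qform d A x = qform d B x"
  by (simp add: qform_def matvec_def dotc_def)

text \<open>Basis independence of the trace: with all eigenvalues equal to one,
  \<open>eigmat\<close> is the identity matrix by completeness.\<close>

lemma sum_qform:
  assumes "orthon d d u"
  shows "(\<Sum>i<d. qform d M (u i)) = (\<Sum>k<d. Re (M k k))"
proof -
  have "(\<Sum>i<d. qform d M (u i)) = frob d M (eigmat d (\<lambda>_. 1) u)"
    by (simp add: frob_eigmat)
  also have "\<dots> = (\<Sum>k<d. \<Sum>l<d. Re (M k l * cnj (of_bool (k = l))))"
    unfolding frob_def using assms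
    by (intro sum.cong refl) (simp add: eigmat_def orthon_complete)
  also have "\<dots> = (\<Sum>k<d. \<Sum>l<d. if k = l then Re (M k l) else 0)"
    by (intro sum.cong refl) simp
  finally show ?thesis by simp
qed

lemma herm_eigmat: "herm d (eigmat d a u)"
  by (simp add: herm_def eigmat_def mult_ac)

lemma frob_eigmat_self:
  assumes "orthon d d u"
  shows "frob d (eigmat d a u) (eigmat d a u) = (\<Sum>i<d. (a i)\<^sup>2)"
  unfolding frob_eigmat using assms
  by (intro sum.cong refl) (simp add: qform_eigmat_eigenvector power2_eq_square)

section \<open>Density operators as probability vectors\<close>

lemma density_eigmat:
  assumes "orthon d d u" "\<And>i. i < d \<Longrightarrow> 0 \<le> p i" "(\<Sum>i<d. p i) = 1"
  shows "density_op d (eigmat d p u)"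
proof -
  have "(\<Sum>k<d. Re (eigmat d p u k k)) = (\<Sum>i<d. p i)"
    using assms(1) by (simp add: qform_eigmat_eigenvector flip: sum_qform)
  with assms show ?thesis
    by (auto simp: density_op_def herm_eigmat qform_eigmat intro!: sum_nonneg)
qed

text \<open>The diagonal of a state in an orthonormal basis is a probability vector; this turns
  matrix inequalities into inequalities between weighted averages.\<close>

lemma density_weights:
  assumes "density_op d W" "orthon d d u"
  shows "0 \<le> qform d W (u i)" "(\<Sum>i<d. qform d W (u i)) = 1"
  using assms by (auto simp: density_op_def sum_qform)

text \<open>The eigenvalues form a probability vector, so each lies in the unit interval and its
  square does not exceed it.\<close>

lemma frob_density_le_1:
  assumes "density_op d W"
  shows "frob d W W \<le> 1"
proof -
  have "herm d W" using assms by (simp add: density_op_def)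
  then obtain u p where u: "orthon d d u" and W: "\<And>k l. k < d \<Longrightarrow> l < d \<Longrightarrow> W k l = eigmat d p u k l"
    by (rule spectral_theorem) blast
  have p: "qform d W (u i) = p i" if "i < d" for i
    using qform_cong[of d W "eigmat d p u", OF W] qform_eigmat_eigenvector[OF u that] by simp
  have p0: "0 \<le> p i" if "i < d" for i
    using density_weights(1)[OF assms u, of i] p[OF that] by simp
  have p1: "(\<Sum>i<d. p i) = 1" using density_weights(2)[OF assms u] p by simp
  have "frob d W W = (\<Sum>i<d. (p i)\<^sup>2)"
    using frob_cong[of d W "eigmat d p u" W "eigmat d p u", OF W W] frob_eigmat_self[OF u] by simp
  also have "\<dots> \<le> (\<Sum>i<d. p i)"
  proof (rule sum_mono)
    fix i assume "i \<in> {..<d}"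
    then have "p i \<le> (\<Sum>i<d. p i)" using p0 by (intro member_le_sum) auto
    with p1 have "p i \<le> 1" by simp
    with p0 \<open>i \<in> {..<d}\<close> show "(p i)\<^sup>2 \<le> p i"
      by (simp add: power2_eq_square mult_left_le)
  qed
  finally show ?thesis using p1 by simp
qed

section \<open>Second order bound for the trace of the exponential\<close>

text \<open>Used in both orders of the bases, this says that the squared overlaps form a doubly
  stochastic matrix.\<close>

lemma orthon_overlap:
  assumes "orthon d d u" "orthon d d v" "j < d"
  shows "(\<Sum>i<d. (cmod (dotc d (v j) (u i)))\<^sup>2) = 1"
  using parseval[OF assms(1), of "v j"] orthon_norm[OF assms(2,3)] by simp

text \<open>The tangents at \<open>x\<close> and at \<open>y\<close> enclose
  \<open>exp x - exp y\<close>. The bound is separated into a term with \<open>exp x\<close> and one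
  with \<open>exp y\<close>, so that after weighting by overlaps each can be summed over the other
  eigenbasis.\<close>

lemma exp_taylor_bound:
  fixes x y :: real
  shows "exp x - exp y - (x - y) * exp y \<le> (x - y)\<^sup>2 * (exp x + exp y)"
proof -
  have "exp x \<ge> exp y * (1 + (x - y))" 
    using mult_left_mono[OF exp_ge_add_one_self[of "x - y"], of "exp y"] by (simp flip: exp_add)
  moreover have "exp y \<ge> exp x * (1 + (y - x))" 
    using mult_left_mono[OF exp_ge_add_one_self[of "y - x"], of "exp x"] by (simp flip: exp_add)
  ultimately have 1: "exp x - exp y \<le> (x - y) * exp x" and 2: "exp x - exp y \<ge> (x - y) * exp y"
    by (simp_all add: algebra_simps)
  have "exp x - exp y - (x - y) * exp y \<le> (x - y) * (exp x - exp y)"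
    using 1 by (simp add: algebra_simps)
  also have "\<dots> \<le> (x - y)\<^sup>2 * (exp x + exp y)"
  proof (cases "x \<ge> y")
    case True
    with 1 have "(x - y) * (exp x - exp y) \<le> (x - y) * ((x - y) * exp x)"
      by (intro mult_left_mono) auto
    also have "\<dots> \<le> (x - y)\<^sup>2 * (exp x + exp y)" by (simp add: distrib_left power2_eq_square flip: mult.assoc)
    finally show ?thesis .
  next
    case False
    with 2 have "(x - y) * (exp x - exp y) \<le> (x - y) * ((x - y) * exp y)"
      by (intro mult_left_mono_neg) auto
    also have "\<dots> \<le> (x - y)\<^sup>2 * (exp x + exp y)" by (simp add: distrib_left power2_eq_square flip: mult.assoc)
    finally show ?thesis .
  qed
  finally show ?thesis .
qed

text \<open>Here \<open>b\<close>, \<open>v\<close> diagonalise a matrix, \<open>a\<close>,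
  \<open>u\<close> its perturbation by \<open>D\<close>, and \<open>c\<close> bounds the squared
  operator norm of \<open>D\<close>. The left side is the average of scalar Taylor remainders at
  pairs of eigenvalues, weighted by squared overlaps.\<close>

lemma trace_exp_perturbation:
  assumes u: "orthon d d u" and v: "orthon d d v"
    and D: "\<And>k l. k < d \<Longrightarrow> l < d \<Longrightarrow> eigmat d a u k l = eigmat d b v k l + D k l"
    and bound: "\<And>x. (\<Sum>k<d. (cmod (matvec d D x k))\<^sup>2) \<le> c * (\<Sum>k<d. (cmod (x k))\<^sup>2)"
  shows "(\<Sum>i<d. exp (a i)) - (\<Sum>j<d. exp (b j)) - frob d D (eigmat d (\<lambda>j. exp (b j)) v)
    \<le> c * ((\<Sum>i<d. exp (a i)) + (\<Sum>j<d. exp (b j)))"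
proof -
  define w where "w i j = (cmod (dotc d (v j) (u i)))\<^sup>2" for i j
  have w1: "(\<Sum>i<d. w i j) = 1" if "j < d" for j
    unfolding w_def by (rule orthon_overlap[OF u v that])
  have w2: "(\<Sum>j<d. w i j) = 1" if "i < d" for i
    unfolding w_def by (subst cmod_dotc_commute) (rule orthon_overlap[OF v u that])
  have w0: "0 \<le> w i j" for i j by (simp add: w_def)
  have mD: "matvec d D x k = matvec d (eigmat d a u) x k - matvec d (eigmat d b v) x k" if "k < d" for x k
    using D[OF that] by (simp add: matvec_def distrib_right sum.distrib)
  have dD: "dotc d (matvec d D x) y = dotc d (matvec d (eigmat d a u) x) y - dotc d (matvec d (eigmat d b v) x) y" for x y
    by (subst dotc_diff_left[symmetric], rule dotc_cong) (simp_all add: mD)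
  \<comment> \<open>Since \<open>u i\<close> and \<open>v j\<close> are eigenvectors of the two
    matrices, the matrix element of \<open>D\<close> between them is \<open>a i - b j\<close> times
    their overlap. Parseval makes the sum the squared norm of \<open>D\<close> applied to
    \<open>v j\<close>.\<close>
  have cols: "(\<Sum>i<d. (a i - b j)\<^sup>2 * w i j) \<le> c" if j: "j < d" for j
  proof -
    have "dotc d (matvec d D (v j)) (u i) = of_real (a i - b j) * dotc d (v j) (u i)" if "i < d" for i
      using that j u v
      by (simp add: dD dotc_matvec_eigmat matvec_eigmat_eigenvector dotc_scale_left algebra_simps)
    then have "(\<Sum>i<d. (a i - b j)\<^sup>2 * w i j) = (\<Sum>i<d. (cmod (dotc d (matvec d D (v j)) (u i)))\<^sup>2)"
      by (simp add: w_def norm_mult power_mult_distrib del: of_real_diff)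
    also have "\<dots> \<le> c * (\<Sum>k<d. (cmod (v j k))\<^sup>2)"
      using bound[of "v j"] parseval[OF u] by simp
    finally show ?thesis using orthon_norm[OF v j] by simp
  qed
  have rows: "(\<Sum>j<d. (a i - b j)\<^sup>2 * w i j) \<le> c" if i: "i < d" for i
  proof -
    have "dotc d (matvec d D (u i)) (v j) = of_real (a i - b j) * dotc d (u i) (v j)" if "j < d" for j
      using that i u v
      by (simp add: dD dotc_matvec_eigmat matvec_eigmat_eigenvector dotc_scale_left algebra_simps)
    then have "(\<Sum>j<d. (a i - b j)\<^sup>2 * w i j) = (\<Sum>j<d. (cmod (dotc d (matvec d D (u i)) (v j)))\<^sup>2)"
      by (simp add: w_def norm_mult power_mult_distrib cmod_dotc_commute[of d "u i"] del: of_real_diff)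
    also have "\<dots> \<le> c * (\<Sum>k<d. (cmod (u i k))\<^sup>2)"
      using bound[of "u i"] parseval[OF v] by simp
    finally show ?thesis using orthon_norm[OF u i] by simp
  qed
  have q: "qform d D (v j) = (\<Sum>i<d. w i j * (a i - b j))" if "j < d" for j
  proof -
    have "qform d D (v j) = qform d (eigmat d a u) (v j) - qform d (eigmat d b v) (v j)"
      by (simp add: qform_def dD)
    also have "\<dots> = (\<Sum>i<d. a i * w i j) - (\<Sum>i<d. w i j) * b j"
      using that v w1 by (simp add: qform_eigmat_eigenvector) (simp add: qform_eigmat w_def)
    also have "\<dots> = (\<Sum>i<d. w i j * (a i - b j))"
      by (subst sum_distrib_right) (simp add: sum_subtractf right_diff_distrib mult.commute)
    finally show ?thesis .
  qed
  \<comment> \<open>Both marginals of \<open>w\<close> are one, so a single sum over either spectrum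
    may be written as a double sum over pairs.\<close>
  have Sa: "(\<Sum>j<d. \<Sum>i<d. w i j * f i) = (\<Sum>i<d. f i)" for f
    by (subst sum.swap) (simp add: w2 flip: sum_distrib_right)
  have Sb: "(\<Sum>j<d. \<Sum>i<d. w i j * f j) = (\<Sum>j<d. f j)" for f
    by (simp add: w1 flip: sum_distrib_right)
  have "frob d D (eigmat d (\<lambda>j. exp (b j)) v) = (\<Sum>j<d. \<Sum>i<d. w i j * ((a i - b j) * exp (b j)))"
    by (simp add: frob_eigmat q sum_distrib_left mult_ac)
  then have "(\<Sum>i<d. exp (a i)) - (\<Sum>j<d. exp (b j)) - frob d D (eigmat d (\<lambda>j. exp (b j)) v)
      = (\<Sum>j<d. \<Sum>i<d. w i j * (exp (a i) - exp (b j) - (a i - b j) * exp (b j)))"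
    using Sa[of "\<lambda>i. exp (a i)"] Sb[of "\<lambda>j. exp (b j)"]
    by (simp add: right_diff_distrib sum_subtractf)
  also have "\<dots> \<le> (\<Sum>j<d. \<Sum>i<d. w i j * ((a i - b j)\<^sup>2 * (exp (a i) + exp (b j))))"
    by (intro sum_mono mult_left_mono exp_taylor_bound w0)
  also have "\<dots> = (\<Sum>j<d. \<Sum>i<d. exp (a i) * ((a i - b j)\<^sup>2 * w i j))
      + (\<Sum>j<d. \<Sum>i<d. exp (b j) * ((a i - b j)\<^sup>2 * w i j))"
    by (simp add: sum.distrib algebra_simps)
  also have "(\<Sum>j<d. \<Sum>i<d. exp (a i) * ((a i - b j)\<^sup>2 * w i j)) = (\<Sum>i<d. exp (a i) * (\<Sum>j<d. (a i - b j)\<^sup>2 * w i j))"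
    by (subst sum.swap) (simp add: sum_distrib_left)
  also have "(\<Sum>j<d. \<Sum>i<d. exp (b j) * ((a i - b j)\<^sup>2 * w i j)) = (\<Sum>j<d. exp (b j) * (\<Sum>i<d. (a i - b j)\<^sup>2 * w i j))"
    by (simp add: sum_distrib_left)
  also have "(\<Sum>i<d. exp (a i) * (\<Sum>j<d. (a i - b j)\<^sup>2 * w i j)) + (\<Sum>j<d. exp (b j) * (\<Sum>i<d. (a i - b j)\<^sup>2 * w i j))
      \<le> (\<Sum>i<d. exp (a i) * c) + (\<Sum>j<d. exp (b j) * c)"
    using rows cols by (intro add_mono sum_mono mult_left_mono) auto
  also have "\<dots> = c * ((\<Sum>i<d. exp (a i)) + (\<Sum>j<d. exp (b j)))"
    by (simp only: sum_distrib_right[symmetric] distrib_left mult.commute[of c])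
  finally show ?thesis .
qed

section \<open>States and effects\<close>

definition entries :: "complex mat \<Rightarrow> nat \<Rightarrow> nat \<Rightarrow> complex" where
  "entries A = (\<lambda>k l. A $$ (k, l))"

lemma entries_mat: "k < d \<Longrightarrow> l < d \<Longrightarrow> entries (mat d d (\<lambda>(k, l). W k l)) k l = W k l"
  by (simp add: entries_def)

lemma hermitian_mat_iff_herm:
  assumes "A \<in> carrier_mat d d"
  shows "hermitian_mat d A \<longleftrightarrow> herm d (entries A)"
proof -
  have dim: "dim_row A = d" "dim_col A = d" using assms by auto
  have adj: "mat_adjoint A $$ (i, j) = cnj (A $$ (j, i))" if "i < d" "j < d" for i j
    using that dim by (simp add: mat_adjoint_def mat_of_rows_index)
  have "mat_adjoint A = A \<longleftrightarrow> (\<forall>i<d. \<forall>j<d. mat_adjoint A $$ (i, j) = A $$ (i, j))"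
    using dim by (auto simp: mat_eq_iff mat_adjoint_def)
  also have "\<dots> \<longleftrightarrow> herm d (entries A)"
    using adj unfolding herm_def entries_def by metis
  finally show ?thesis using assms by (simp add: hermitian_mat_def)
qed

lemma sprod_matvec:
  assumes "A \<in> carrier_mat d d" "v \<in> carrier_vec d"
  shows "(A *\<^sub>v v) \<bullet>c v = dotc d (matvec d (entries A) (\<lambda>k. v $ k)) (\<lambda>k. v $ k)"
  using assms
  by (simp add: dotc_def matvec_def entries_def scalar_prod_def atLeast0LessThan)

text \<open>Nonnegativity in the complex order includes being real. For a Hermitian matrix the form
  equals its own conjugate, so only the sign of the real part remains.\<close>

lemma psd_mat_iff:
  assumes "A \<in> carrier_mat d d"
  shows "psd_mat d A \<longleftrightarrow> herm d (entries A) \<and> (\<forall>x. 0 \<le> qform d (entries A) x)"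
proof -
  have real: "0 \<le> dotc d (matvec d (entries A) x) x \<longleftrightarrow> 0 \<le> qform d (entries A) x"
    if "herm d (entries A)" for x
  proof -
    have "cnj (dotc d (matvec d (entries A) x) x) = dotc d (matvec d (entries A) x) x"
      using herm_dotc_matvec[OF that, of x x] by (simp add: cnj_dotc)
    then have "Im (dotc d (matvec d (entries A) x) x) = 0"
      by (metis Reals_cnj_iff complex_is_Real_iff)
    then show ?thesis by (simp add: qform_def less_eq_complex_def)
  qed
  have "(\<forall>v \<in> carrier_vec d. 0 \<le> (A *\<^sub>v v) \<bullet>c v) \<longleftrightarrow> (\<forall>x. 0 \<le> dotc d (matvec d (entries A) x) x)"
  proof
    assume *: "\<forall>v \<in> carrier_vec d. 0 \<le> (A *\<^sub>v v) \<bullet>c v"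
    show "\<forall>x. 0 \<le> dotc d (matvec d (entries A) x) x"
    proof
      fix x :: "nat \<Rightarrow> complex"
      have "0 \<le> (A *\<^sub>v vec d x) \<bullet>c vec d x" using * by simp
      also have "\<dots> = dotc d (matvec d (entries A) x) x"
        by (simp only: sprod_matvec[OF assms vec_carrier]) (simp add: dotc_def matvec_def)
      finally show "0 \<le> dotc d (matvec d (entries A) x) x" .
    qed
  qed (use assms in \<open>simp add: sprod_matvec\<close>)
  with real assms show ?thesis by (auto simp: psd_mat_def hermitian_mat_iff_herm)
qed

lemma qstates_carrier: "\<omega> \<in> qstates n \<Longrightarrow> \<omega> \<in> carrier_mat (2 ^ n) (2 ^ n)"
  by (simp add: qstates_def psd_mat_def hermitian_mat_def)

lemma density_qstates:
  assumes "\<omega> \<in> qstates n"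
  shows "density_op (2 ^ n) (entries \<omega>)"
proof -
  have c: "\<omega> \<in> carrier_mat (2 ^ n) (2 ^ n)" using assms by (rule qstates_carrier)
  have "mtrace \<omega> = 1" using assms by (simp add: qstates_def)
  then have "Re (mtrace \<omega>) = 1" by simp
  then have "(\<Sum>k<2 ^ n. Re (entries \<omega> k k)) = 1"
    using c by (simp add: mtrace_def entries_def)
  with assms c show ?thesis by (simp add: qstates_def density_op_def psd_mat_iff)
qed

lemma mat_density_qstates:
  assumes "density_op (2 ^ n) W"
  shows "mat (2 ^ n) (2 ^ n) (\<lambda>(k, l). W k l) \<in> qstates n"
proof -
  let ?d = "2 ^ n :: nat" and ?M = "mat (2 ^ n) (2 ^ n) (\<lambda>(k, l). W k l)"
  have W: "herm ?d W" "\<And>x. 0 \<le> qform ?d W x" "(\<Sum>k<?d. Re (W k k)) = 1"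
    using assms by (auto simp: density_op_def)
  have "herm ?d (entries ?M)" using W(1) by (simp add: herm_def entries_mat)
  moreover have "qform ?d (entries ?M) x = qform ?d W x" for x
    by (rule qform_cong) (simp add: entries_mat)
  ultimately have "psd_mat ?d ?M" using W(2) by (simp add: psd_mat_iff)
  moreover have "mtrace ?M = 1"
  proof -
    have "Im (W k k) = 0" if "k < ?d" for k
      using hermD[OF W(1) that that] by (metis Reals_cnj_iff complex_is_Real_iff)
    then show ?thesis using W(3) by (simp add: mtrace_def complex_eq_iff)
  qed
  ultimately show ?thesis by (simp add: qstates_def)
qed

text \<open>Hermiticity of the state turns the transposed entry in the trace of the product into the
  conjugate that \<open>frob\<close> contains.\<close>

lemma outcome_eq_frob:
  assumes "E \<in> carrier_mat d d" "\<omega> \<in> carrier_mat d d" "herm d (entries \<omega>)"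
  shows "outcome E \<omega> = frob d (entries E) (entries \<omega>)"
proof -
  have "mtrace (E * \<omega>) = (\<Sum>k<d. \<Sum>l<d. entries E k l * entries \<omega> l k)"
    using assms(1,2) by (simp add: mtrace_def scalar_prod_def entries_def atLeast0LessThan)
  also have "\<dots> = (\<Sum>k<d. \<Sum>l<d. entries E k l * cnj (entries \<omega> k l))"
    by (intro sum.cong refl) (simp add: hermD[OF assms(3)])
  finally show ?thesis by (simp add: outcome_def frob_def)
qed

section \<open>Spectrum, outcomes and rank of effects\<close>

lemma effect_carrier: "E \<in> effects n \<Longrightarrow> E \<in> carrier_mat (2 ^ n) (2 ^ n)"
  by (simp add: effects_def hermitian_mat_def)

lemma effect_herm:
  assumes "E \<in> effects n"
  shows "herm (2 ^ n) (entries E)"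
  using hermitian_mat_iff_herm[OF effect_carrier[OF assms]] assms by (simp add: effects_def)

text \<open>The two bounds on an eigenvalue come from evaluating the forms of \<open>E\<close> and
  of the identity minus \<open>E\<close> at its eigenvector.\<close>

lemma effect_spectrum:
  assumes "E \<in> effects n"
  obtains w e where "orthon (2 ^ n) (2 ^ n) w"
    "\<And>k l. k < 2 ^ n \<Longrightarrow> l < 2 ^ n \<Longrightarrow> entries E k l = eigmat (2 ^ n) e w k l"
    "\<And>i. i < 2 ^ n \<Longrightarrow> 0 \<le> e i" "\<And>i. i < 2 ^ n \<Longrightarrow> e i \<le> 1"
proof -
  let ?d = "2 ^ n :: nat"
  have E: "E \<in> carrier_mat ?d ?d" using assms by (rule effect_carrier)
  obtain w e where w: "orthon ?d ?d w"
    and e: "\<And>k l. k < ?d \<Longrightarrow> l < ?d \<Longrightarrow> entries E k l = eigmat ?d e w k l"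
    using spectral_theorem[OF effect_herm[OF assms]] by blast
  have q: "qform ?d (entries E) (w i) = e i" if "i < ?d" for i
    using qform_cong[of ?d "entries E" "eigmat ?d e w", OF e] qform_eigmat_eigenvector[OF w that]
    by simp
  have "0 \<le> e i" if "i < ?d" for i
    using assms q[OF that] psd_mat_iff[OF E] by (simp add: effects_def) metis
  moreover have "e i \<le> 1" if "i < ?d" for i
  proof -
    have "1\<^sub>m ?d - E \<in> carrier_mat ?d ?d" using E by (rule minus_carrier_mat)
    then have "0 \<le> qform ?d (entries (1\<^sub>m ?d - E)) (w i)"
      using assms psd_mat_iff by (simp add: effects_def)
    also have "\<dots> = Re (dotc ?d (\<lambda>k. w i k - matvec ?d (entries E) (w i) k) (w i))"
    proof -
      have "matvec ?d (entries (1\<^sub>m ?d - E)) (w i) k = w i k - matvec ?d (entries E) (w i) k" if "k < ?d" for k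
      proof -
        have "matvec ?d (entries (1\<^sub>m ?d - E)) (w i) k
            = (\<Sum>l<?d. (if k = l then w i l else 0) - entries E k l * w i l)"
          unfolding matvec_def using E that by (intro sum.cong refl) (simp add: entries_def algebra_simps)
        then show ?thesis using that by (simp add: sum_subtractf matvec_def)
      qed
      then show ?thesis unfolding qform_def by (intro arg_cong[of _ _ Re] dotc_cong) auto
    qed
    also have "\<dots> = 1 - e i"
      using q[OF that] orthonD[OF w that that] by (simp add: dotc_diff_left qform_def)
    finally show ?thesis by simp
  qed
  ultimately show ?thesis using that[OF w e] by blast
qed

lemma matvec_entry_cong:
  "(\<And>k l. k < d \<Longrightarrow> l < d \<Longrightarrow> A k l = B k l) \<Longrightarrow> k < d \<Longrightarrow> matvec d A x k = matvec d B x k"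
  by (simp add: matvec_def)

text \<open>In the eigenbasis each coordinate is multiplied by a number in the unit interval. This
  supplies the operator norm hypothesis of \<open>trace_exp_perturbation\<close>.\<close>

lemma effect_contraction:
  assumes "E \<in> effects n"
  shows "(\<Sum>k<2 ^ n. (cmod (matvec (2 ^ n) (entries E) x k))\<^sup>2) \<le> (\<Sum>k<2 ^ n. (cmod (x k))\<^sup>2)"
proof -
  let ?d = "2 ^ n :: nat"
  obtain w e where w: "orthon ?d ?d w"
    and e: "\<And>k l. k < ?d \<Longrightarrow> l < ?d \<Longrightarrow> entries E k l = eigmat ?d e w k l"
    and e0: "\<And>i. i < ?d \<Longrightarrow> 0 \<le> e i" and e1: "\<And>i. i < ?d \<Longrightarrow> e i \<le> 1"
    using effect_spectrum[OF assms] by blast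
  have "(\<Sum>k<?d. (cmod (matvec ?d (entries E) x k))\<^sup>2) = (\<Sum>k<?d. (cmod (matvec ?d (eigmat ?d e w) x k))\<^sup>2)"
    using matvec_entry_cong[OF e] by simp
  also have "\<dots> = (\<Sum>i<?d. (cmod (dotc ?d (matvec ?d (eigmat ?d e w) x) (w i)))\<^sup>2)"
    by (rule parseval[OF w, symmetric])
  also have "\<dots> = (\<Sum>i<?d. (e i)\<^sup>2 * (cmod (dotc ?d x (w i)))\<^sup>2)"
    by (intro sum.cong refl) (simp add: dotc_matvec_eigmat[OF w] norm_mult power_mult_distrib)
  also have "\<dots> \<le> (\<Sum>i<?d. 1 * (cmod (dotc ?d x (w i)))\<^sup>2)"
    using e0 e1 by (intro sum_mono mult_right_mono) (auto simp: power_le_one)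
  also have "\<dots> = (\<Sum>k<?d. (cmod (x k))\<^sup>2)" using parseval[OF w] by simp
  finally show ?thesis .
qed

lemma outcome_effect_eq_frob:
  assumes "E \<in> effects n" "\<omega> \<in> qstates n"
  shows "outcome E \<omega> = frob (2 ^ n) (entries E) (entries \<omega>)"
  using assms density_qstates
  by (intro outcome_eq_frob effect_carrier qstates_carrier) (auto simp: density_op_def)

text \<open>The outcome is an average of the eigenvalues of \<open>E\<close>, weighted by the
  diagonal of the state in the eigenbasis.\<close>

lemma outcome_bounds:
  assumes "E \<in> effects n" "\<omega> \<in> qstates n"
  shows "0 \<le> outcome E \<omega>" "outcome E \<omega> \<le> 1"
proof -
  let ?d = "2 ^ n :: nat"
  obtain w e where w: "orthon ?d ?d w"
    and e: "\<And>k l. k < ?d \<Longrightarrow> l < ?d \<Longrightarrow> entries E k l = eigmat ?d e w k l"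
    and e0: "\<And>i. i < ?d \<Longrightarrow> 0 \<le> e i" and e1: "\<And>i. i < ?d \<Longrightarrow> e i \<le> 1"
    using effect_spectrum[OF assms(1)] by blast
  note W = density_weights[OF density_qstates[OF assms(2)] w]
  have "outcome E \<omega> = frob ?d (entries \<omega>) (eigmat ?d e w)"
    using frob_cong[of ?d "entries E" "eigmat ?d e w" "entries \<omega>" "entries \<omega>", OF e refl] outcome_effect_eq_frob[OF assms]
    by (simp add: frob_commute)
  then have *: "outcome E \<omega> = (\<Sum>i<?d. e i * qform ?d (entries \<omega>) (w i))"
    by (simp add: frob_eigmat)
  show "0 \<le> outcome E \<omega>" unfolding * using e0 W(1) by (intro sum_nonneg) auto
  have "outcome E \<omega> \<le> (\<Sum>i<?d. 1 * qform ?d (entries \<omega>) (w i))"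
    unfolding * using e1 W(1) by (intro sum_mono mult_right_mono) auto
  then show "outcome E \<omega> \<le> 1" using W(2) by simp
qed

text \<open>Eigenvectors are columns of an invertible matrix, hence independent, and one with
  nonzero eigenvalue lies in the column space, being the image of itself divided by the
  eigenvalue.\<close>

lemma card_nonzero_eigenvalues_le_rank:
  assumes E: "E \<in> carrier_mat d d" and w: "orthon d d w"
    and e: "\<And>k l. k < d \<Longrightarrow> l < d \<Longrightarrow> entries E k l = eigmat d e w k l"
  shows "card {i. i < d \<and> e i \<noteq> 0} \<le> mat_rank d E"
proof -
  interpret vec_space "TYPE(complex)" d .
  define U where "U = mat d d (\<lambda>(k, i). w i k)"
  define W where "W = mat d d (\<lambda>(i, k). cnj (w i k))"
  define S where "S = (\<lambda>i. col U i) ` {i. i < d \<and> e i \<noteq> 0}"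
  have U: "U \<in> carrier_mat d d" and W: "W \<in> carrier_mat d d" by (auto simp: U_def W_def)
  have colU: "col U i = vec d (w i)" if "i < d" for i using that by (auto simp: U_def)
  have "W * U = 1\<^sub>m d"
  proof (rule eq_matI)
    fix i j assume "i < dim_row (1\<^sub>m d :: complex mat)" "j < dim_col (1\<^sub>m d :: complex mat)"
    then show "(W * U) $$ (i, j) = 1\<^sub>m d $$ (i, j)"
      using w by (auto simp: U_def W_def scalar_prod_def orthon_def dotc_def atLeast0LessThan mult.commute)
  qed (auto simp: U_def W_def)
  then have detU: "det U \<noteq> 0" using det_mult[OF W U] by auto
  then have "lin_indpt (set (cols U))" using lin_dep_cols_imp_det_0[OF U] by blast
  moreover have S_cols: "S \<subseteq> set (cols U)" using U by (auto simp: S_def cols_def)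
  ultimately have S_li: "lin_indpt S" by (rule subset_li_is_li)
  have inj: "inj_on (\<lambda>i. col U i) {i. i < d \<and> e i \<noteq> 0}"
  proof (rule inj_onI, rule ccontr)
    fix i j assume ij: "i \<in> {i. i < d \<and> e i \<noteq> 0}" "j \<in> {i. i < d \<and> e i \<noteq> 0}"
      "col U i = col U j" "i \<noteq> j"
    then have "vec d (w i) = vec d (w j)" by (simp add: colU)
    then have "w i k = w j k" if "k < d" for k using that by (metis index_vec)
    then have "dotc d (w i) (w j) = dotc d (w i) (w i)" by (intro dotc_cong) auto
    with ij w show False by (simp add: orthonD)
  qed
  have S_span: "S \<subseteq> span (set (cols E))"
  proof
    fix v assume "v \<in> S"
    then obtain i where i: "i < d" "e i \<noteq> 0" "v = vec d (w i)" by (auto simp: S_def colU)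
    define y where "y = vec d (\<lambda>k. w i k / of_real (e i))"
    have "E *\<^sub>v y = v"
    proof (rule eq_vecI)
      fix k assume "k < dim_vec v"
      then have k: "k < d" using i by simp
      have "(E *\<^sub>v y) $ k = matvec d (entries E) (w i) k / of_real (e i)"
        using E k by (simp add: y_def scalar_prod_def matvec_def entries_def atLeast0LessThan sum_divide_distrib)
      also have "matvec d (entries E) (w i) k = of_real (e i) * w i k"
        using matvec_entry_cong[OF e k] matvec_eigmat_eigenvector[OF w i(1)] by simp
      finally show "(E *\<^sub>v y) $ k = v $ k" using i k by simp
    qed (use E i in simp)
    moreover have "y \<in> carrier_vec d" by (simp add: y_def)
    ultimately have "v \<in> col_space E" using E i by (auto simp: col_space_eq[OF E])
    then show "v \<in> span (set (cols E))" by (simp add: col_space_def)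
  qed
  have colsE: "set (cols E) \<subseteq> carrier_vec d" using cols_dim[of E] E by simp
  have sub: "subspace class_ring (span (set (cols E))) V"
    using colsE by (rule span_is_subspace)
  then have vs: "vectorspace class_ring (span_vs (set (cols E)))"
    by (rule subspace_is_vs)
  \<comment> \<open>Independence is transferred to the column space viewed as a vector space of its
    own, whose dimension is the rank.\<close>
  have "module.lin_indpt class_ring (span_vs (set (cols E))) S"
    using span_li_not_depend(2)[OF S_span span_is_submodule[OF colsE]] S_li by simp
  then have "card S \<le> vectorspace.dim class_ring (span_vs (set (cols E)))"
    using vectorspace.li_le_dim(2)[OF vs fin_dim_span_cols[OF E]] S_span by simp
  then show ?thesis using inj by (simp add: mat_rank_def rank_def S_def card_image)
qed

text \<open>With eigenvalues in the unit interval, each square is at most the indicator of being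
  nonzero.\<close>

lemma effect_frob_le_rank:
  assumes "E \<in> effects n"
  shows "frob (2 ^ n) (entries E) (entries E) \<le> real (mat_rank (2 ^ n) E)"
proof -
  let ?d = "2 ^ n :: nat"
  obtain w e where w: "orthon ?d ?d w"
    and e: "\<And>k l. k < ?d \<Longrightarrow> l < ?d \<Longrightarrow> entries E k l = eigmat ?d e w k l"
    and e0: "\<And>i. i < ?d \<Longrightarrow> 0 \<le> e i" and e1: "\<And>i. i < ?d \<Longrightarrow> e i \<le> 1"
    using effect_spectrum[OF assms] by blast
  have "frob ?d (entries E) (entries E) = (\<Sum>i<?d. (e i)\<^sup>2)"
    using frob_cong[of ?d "entries E" "eigmat ?d e w" "entries E" "eigmat ?d e w", OF e e] frob_eigmat_self[OF w] by simp
  also have "\<dots> \<le> (\<Sum>i<?d. if e i \<noteq> 0 then 1 else 0)"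
    using e0 e1 by (intro sum_mono) (auto simp: power_le_one)
  also have "\<dots> = real (card {i. i < ?d \<and> e i \<noteq> 0})"
    by (simp add: sum.If_cases Int_def)
  also have "\<dots> \<le> real (mat_rank ?d E)"
    using card_nonzero_eigenvalues_le_rank[OF effect_carrier[OF assms] w e] by simp
  finally show ?thesis .
qed

section \<open>Potential-based strategies\<close>

text \<open>Convexity supplies a slope; testing the tangent at \<open>x + 1\<close> and
  \<open>x - 1\<close> against the Lipschitz bound limits its absolute value.\<close>

lemma lipschitz_subgradient:
  fixes l :: "real \<Rightarrow> real"
  assumes "convex_on UNIV l" "L-lipschitz_on UNIV l"
  shows "\<exists>g. \<bar>g\<bar> \<le> L \<and> (\<forall>y. l x + g * (y - x) \<le> l y)"
proof -
  obtain g where g: "l x + g * (y - x) \<le> l y" for y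
    using convex_le_Inf_differential[OF assms(1), of x] by auto
  have lip: "\<bar>l y - l x\<bar> \<le> L * \<bar>y - x\<bar>" for y
    using lipschitz_onD[OF assms(2), of y x] by (simp add: dist_real_def)
  have "g \<le> L" using g[of "x + 1"] lip[of "x + 1"] by simp
  moreover have "- g \<le> L" using g[of "x - 1"] lip[of "x - 1"] by simp
  ultimately show ?thesis using g by (intro exI[of _ g]) auto
qed

lemma qstates_nonempty: "qstates n \<noteq> {}"
proof -
  let ?u = "\<lambda>i k :: nat. of_bool (i = k) :: complex"
  have "dotc (2 ^ n) (?u i) (?u j) = of_bool (i = j)" if "i < 2 ^ n" for i j
  proof -
    have "dotc (2 ^ n) (?u i) (?u j) = (\<Sum>k<2 ^ n. if i = k then of_bool (j = k) else 0)"
      unfolding dotc_def by (intro sum.cong refl) auto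
    then show ?thesis using that by auto
  qed
  then have "orthon (2 ^ n) (2 ^ n) ?u" by (simp add: orthon_def)
  then have "density_op (2 ^ n) (eigmat (2 ^ n) (\<lambda>i. of_bool (i = 0)) ?u)"
    by (rule density_eigmat) (auto simp: of_bool_def)
  then show ?thesis using mat_density_qstates by blast
qed

text \<open>A bound against every fixed comparator passes to the infimum, the set of states being
  nonempty. Attainment of the minimum does not enter.\<close>

lemma regret_le:
  assumes "\<And>\<sigma>. \<sigma> \<in> qstates n \<Longrightarrow>
    (\<Sum>(\<omega>, E, l)\<leftarrow>h. l (outcome E \<omega>)) - (\<Sum>(_, E, l)\<leftarrow>h. l (outcome E \<sigma>)) \<le> B"
  shows "regret n h \<le> B"
proof -
  have "(\<Sum>(\<omega>, E, l)\<leftarrow>h. l (outcome E \<omega>)) - B \<le> (INF \<omega> \<in> qstates n. \<Sum>(_, E, l)\<leftarrow>h. l (outcome E \<omega>))"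
  proof (rule cINF_greatest[OF qstates_nonempty])
    fix \<sigma> assume "\<sigma> \<in> qstates n"
    from assms[OF this] show "(\<Sum>(\<omega>, E, l)\<leftarrow>h. l (outcome E \<omega>)) - B \<le> (\<Sum>(_, E, l)\<leftarrow>h. l (outcome E \<sigma>))"
      by linarith
  qed
  then show ?thesis by (simp add: regret_def)
qed

text \<open>All outcomes lie in the unit interval, so one round costs at most \<open>L\<close>
  whatever is played.\<close>

lemma constant_strategy:
  assumes "L \<ge> 0"
  shows "\<exists>S. is_learner n S \<and> (\<forall>A. (\<forall>(\<omega>, m) \<in> set (play S A T). admissible_move n r L m) \<longrightarrow>
    regret n (play S A T) \<le> L * real T)"
proof -
  obtain \<omega>0 where \<omega>0: "\<omega>0 \<in> qstates n" using qstates_nonempty by blast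
  define S :: learner where "S = (\<lambda>_. \<omega>0)"
  have "(\<Sum>(\<omega>, E, l)\<leftarrow>play S A t. l (outcome E \<omega>)) - (\<Sum>(_, E, l)\<leftarrow>play S A t. l (outcome E \<sigma>)) \<le> L * real t"
    if "\<forall>(\<omega>, m) \<in> set (play S A t). admissible_move n r L m" "\<sigma> \<in> qstates n" for A t \<sigma>
    using that(1)
  proof (induction t)
    case (Suc t)
    define h where "h = play S A t"
    obtain E l where m: "A h \<omega>0 = (E, l)" by (cases "A h \<omega>0")
    have play: "play S A (Suc t) = h @ [(\<omega>0, E, l)]"
      using m by (simp add: h_def S_def Let_def)
    have E: "E \<in> effects n" and l: "L-lipschitz_on UNIV l"
      using Suc.prems unfolding play by (auto simp: admissible_move_def)
    have "l (outcome E \<omega>0) - l (outcome E \<sigma>) \<le> L * \<bar>outcome E \<omega>0 - outcome E \<sigma>\<bar>"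
      using lipschitz_onD[OF l, of "outcome E \<omega>0" "outcome E \<sigma>"] by (simp add: dist_real_def)
    also have "\<dots> \<le> L * 1"
      using outcome_bounds[OF E \<omega>0] outcome_bounds[OF E that(2)] assms
      by (intro mult_left_mono) auto
    finally have "l (outcome E \<omega>0) - l (outcome E \<sigma>) \<le> L" by simp
    moreover have "\<forall>(\<omega>, m) \<in> set (play S A t). admissible_move n r L m"
      using Suc.prems unfolding play h_def by simp
    note Suc.IH[OF this]
    ultimately show ?case unfolding play by (simp add: h_def algebra_simps)
  qed simp
  then have "\<forall>A. (\<forall>(\<omega>, m) \<in> set (play S A T). admissible_move n r L m) \<longrightarrow> regret n (play S A T) \<le> L * real T"
    by (intro allI impI regret_le) blast
  moreover have "is_learner n S" using \<omega>0 by (simp add: is_learner_def S_def)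
  ultimately show ?thesis by blast
qed

lemma herm_add: "herm d X \<Longrightarrow> herm d Y \<Longrightarrow> herm d (\<lambda>k l. X k l + of_real s * Y k l)"
  by (simp add: herm_def)

text \<open>The hypothesis \<open>step\<close> says that \<open>P X\<close> acts as the gradient of
  \<open>\<Phi>\<close> up to a second order error \<open>c\<close>, and \<open>upper\<close> that
  \<open>\<Phi>\<close> dominates the linear payoff of every state up to \<open>b\<close>. The
  per-round inequalities telescope.\<close>

lemma potential_strategy:
  fixes \<Phi> :: "(nat \<Rightarrow> nat \<Rightarrow> complex) \<Rightarrow> real"
  assumes P: "\<And>X. P X \<in> qstates n"
    and step: "\<And>X E s. herm (2 ^ n) X \<Longrightarrow> E \<in> effects n \<Longrightarrow> mat_rank (2 ^ n) E \<le> r \<Longrightarrow> \<bar>s\<bar> \<le> \<eta> * L \<Longrightarrow>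
      \<Phi> (\<lambda>k l. X k l + of_real s * entries E k l) \<le> \<Phi> X + s * outcome E (P X) + c"
    and upper: "\<And>X \<sigma>. herm (2 ^ n) X \<Longrightarrow> \<sigma> \<in> qstates n \<Longrightarrow> frob (2 ^ n) X (entries \<sigma>) \<le> \<Phi> X + b"
    and "\<eta> > 0"
  shows "\<exists>S. is_learner n S \<and> (\<forall>A. (\<forall>(\<omega>, m) \<in> set (play S A T). admissible_move n r L m) \<longrightarrow>
    regret n (play S A T) \<le> (\<Phi> (\<lambda>_ _. 0) + b + real T * c) / \<eta>)"
proof -
  \<comment> \<open>A fixed choice of subgradient lets the learner rebuild \<open>X\<close> by
    replaying the adversary's moves, the only information in its history; its own past plays are
    recomputed in \<open>upd\<close>.\<close>
  define sg where "sg l x = (SOME g. \<bar>g\<bar> \<le> L \<and> (\<forall>y. l x + g * (y - x) \<le> l y))" for l :: "real \<Rightarrow> real" and x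
  define upd where "upd X m = (case m of (E, l) \<Rightarrow>
    (\<lambda>k k'. X k k' + of_real (- \<eta> * sg l (outcome E (P X))) * entries E k k'))" for X and m :: move
  define st where "st ms = foldl upd (\<lambda>_ _. 0) ms" for ms
  define S :: learner where "S ms = P (st ms)" for ms
  \<comment> \<open>The regret against \<open>\<sigma>\<close>, scaled by \<open>\<eta>\<close>, is
    bounded by the comparator's linear payoff at the current \<open>X\<close> minus the growth of
    the potential, plus the accumulated errors.\<close>
  have inv: "herm (2 ^ n) (st (map snd (play S A t))) \<and>
      \<eta> * ((\<Sum>(\<omega>, E, l)\<leftarrow>play S A t. l (outcome E \<omega>)) - (\<Sum>(_, E, l)\<leftarrow>play S A t. l (outcome E \<sigma>)))
        \<le> frob (2 ^ n) (st (map snd (play S A t))) (entries \<sigma>) - \<Phi> (st (map snd (play S A t))) + \<Phi> (\<lambda>_ _. 0) + real t * c"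
    if "\<forall>(\<omega>, m) \<in> set (play S A t). admissible_move n r L m" "\<sigma> \<in> qstates n" for A t \<sigma>
    using that(1)
  proof (induction t)
    case 0
    then show ?case by (simp add: st_def herm_def frob_def)
  next
    case (Suc t)
    define h where "h = play S A t"
    define X where "X = st (map snd h)"
    obtain E l where m: "A h (P X) = (E, l)" by (cases "A h (P X)")
    have play: "play S A (Suc t) = h @ [(P X, E, l)]"
      using m by (simp add: h_def S_def X_def Let_def)
    define g where "g = sg l (outcome E (P X))"
    define X' where "X' = (\<lambda>k k'. X k k' + of_real (- \<eta> * g) * entries E k k')"
    have st': "st (map snd (play S A (Suc t))) = X'"
      unfolding play by (simp add: st_def X'_def X_def g_def upd_def)
    have E: "E \<in> effects n" "mat_rank (2 ^ n) E \<le> r" and l: "convex_on UNIV l" "L-lipschitz_on UNIV l"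
      using Suc.prems unfolding play by (auto simp: admissible_move_def)
    have g: "\<bar>g\<bar> \<le> L" "l (outcome E (P X)) + g * (y - outcome E (P X)) \<le> l y" for y
      using someI_ex[OF lipschitz_subgradient[OF l, of "outcome E (P X)"]] by (auto simp: g_def sg_def)
    have "\<forall>(\<omega>, m) \<in> set (play S A t). admissible_move n r L m"
      using Suc.prems unfolding play h_def by simp
    note IH = Suc.IH[OF this, folded h_def, folded X_def]
    have X: "herm (2 ^ n) X" using IH by simp
    have X': "herm (2 ^ n) X'" unfolding X'_def by (intro herm_add X effect_herm E)
    have "\<bar>- \<eta> * g\<bar> \<le> \<eta> * L" using g(1) \<open>\<eta> > 0\<close> by (simp add: abs_mult)
    from step[OF X E this] have \<Phi>: "\<Phi> X' \<le> \<Phi> X + (- \<eta> * g) * outcome E (P X) + c"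
      by (simp only: X'_def)
    have fr: "frob (2 ^ n) X' (entries \<sigma>) = frob (2 ^ n) X (entries \<sigma>) + (- \<eta> * g) * outcome E \<sigma>"
      unfolding X'_def by (simp only: frob_add_left outcome_effect_eq_frob[OF E(1) that(2)])
    \<comment> \<open>Only here does convexity enter: the loss difference is at most that of the
      tangent at the learner's outcome.\<close>
    have "\<eta> * (l (outcome E (P X)) - l (outcome E \<sigma>)) \<le> \<eta> * (g * outcome E (P X) - g * outcome E \<sigma>)"
      using g(2)[of "outcome E \<sigma>"] \<open>\<eta> > 0\<close> by (intro mult_left_mono) (auto simp: right_diff_distrib)
    with X' IH \<Phi> fr show ?case
      unfolding st' unfolding play by (simp add: algebra_simps)
  qed
  have "regret n (play S A T) \<le> (\<Phi> (\<lambda>_ _. 0) + b + real T * c) / \<eta>"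
    if adm: "\<forall>(\<omega>, m) \<in> set (play S A T). admissible_move n r L m" for A
  proof (rule regret_le)
    fix \<sigma> assume \<sigma>: "\<sigma> \<in> qstates n"
    note I = inv[OF adm \<sigma>]
    from I upper[OF conjunct1[OF I] \<sigma>] \<open>\<eta> > 0\<close>
    show "(\<Sum>(\<omega>, E, l)\<leftarrow>play S A T. l (outcome E \<omega>)) - (\<Sum>(_, E, l)\<leftarrow>play S A T. l (outcome E \<sigma>))
      \<le> (\<Phi> (\<lambda>_ _. 0) + b + real T * c) / \<eta>"
      by (simp add: pos_le_divide_eq mult.commute)
  qed
  moreover have "is_learner n S" using P by (simp add: is_learner_def S_def)
  ultimately show ?thesis by blast
qed

text \<open>A learner must return a genuine matrix in \<open>qstates\<close> on every history,
  including those with inadmissible moves; a non-Hermitian \<open>X\<close> therefore receives an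
  arbitrary state. The second hypothesis says that \<open>Q\<close> sees only entries inside the
  matrix.\<close>

lemma exists_density_choice:
  assumes "\<And>X. herm (2 ^ n) X \<Longrightarrow> \<exists>W. density_op (2 ^ n) W \<and> Q X W"
    and "\<And>X W W'. Q X W \<Longrightarrow> (\<And>k l. k < 2 ^ n \<Longrightarrow> l < 2 ^ n \<Longrightarrow> W' k l = W k l) \<Longrightarrow> Q X W'"
  shows "\<exists>P. (\<forall>X. P X \<in> qstates n) \<and> (\<forall>X. herm (2 ^ n) X \<longrightarrow> Q X (entries (P X)))"
proof -
  have "\<exists>\<omega> \<in> qstates n. herm (2 ^ n) X \<longrightarrow> Q X (entries \<omega>)" for X
  proof (cases "herm (2 ^ n) X")
    case True
    then obtain W where W: "density_op (2 ^ n) W" "Q X W" using assms(1) by blast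
    have "Q X (entries (mat (2 ^ n) (2 ^ n) (\<lambda>(k, l). W k l)))"
      by (rule assms(2)[OF W(2)]) (simp add: entries_mat)
    with mat_density_qstates[OF W(1)] show ?thesis by blast
  qed (use qstates_nonempty in blast)
  then show ?thesis by metis
qed

section \<open>Projection onto the states and the rank-dependent bound\<close>

text \<open>The sum is continuous in the threshold, vanishes at an upper bound of all
  \<open>a i\<close> and is at least one at \<open>a 0 - 1\<close>; the intermediate value theorem
  applies.\<close>

lemma simplex_threshold:
  fixes a :: "nat \<Rightarrow> real"
  assumes "d > 0"
  shows "\<exists>\<tau>. (\<Sum>i<d. max (a i - \<tau>) 0) = 1"
proof -
  define f where "f \<tau> = (\<Sum>i<d. max (a i - \<tau>) 0)" for \<tau>
  define U where "U = (\<Sum>i<d. \<bar>a i\<bar>)"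
  have U: "a i \<le> U" if "i < d" for i
  proof -
    have "\<bar>a i\<bar> \<le> U" unfolding U_def using that by (intro member_le_sum) auto
    then show ?thesis by simp
  qed
  have "f U = 0" unfolding f_def using U by (intro sum.neutral) auto
  moreover have "1 \<le> f (a 0 - 1)"
  proof -
    have "max (a 0 - (a 0 - 1)) 0 \<le> f (a 0 - 1)"
      unfolding f_def using assms by (intro member_le_sum[of 0 _ "\<lambda>i. max (a i - (a 0 - 1)) 0"]) auto
    then show ?thesis by simp
  qed
  moreover have "continuous_on {a 0 - 1..U} f" unfolding f_def by (intro continuous_intros)
  ultimately have "\<exists>\<tau>. a 0 - 1 \<le> \<tau> \<and> \<tau> \<le> U \<and> f \<tau> = 1"
    using U[of 0] assms by (intro IVT2') auto
  then show ?thesis unfolding f_def by blast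
qed

text \<open>Thresholding the spectrum of \<open>X\<close> gives its Frobenius projection \<open>W\<close> onto the states; the
  inequality is the variational characterisation of that projection.\<close>

lemma exists_density_projection:
  assumes "herm d X" "d > 0"
  shows "\<exists>W. density_op d W \<and>
    (\<forall>V. density_op d V \<longrightarrow> frob d X V - frob d W V \<le> frob d X W - frob d W W)"
proof -
  obtain u a where u: "orthon d d u" and a: "\<And>k l. k < d \<Longrightarrow> l < d \<Longrightarrow> X k l = eigmat d a u k l"
    using spectral_theorem[OF assms(1)] by blast
  obtain \<tau> where \<tau>: "(\<Sum>i<d. max (a i - \<tau>) 0) = 1" using simplex_threshold[OF assms(2)] by blast
  define p where "p i = max (a i - \<tau>) 0" for i
  define W where "W = eigmat d p u"
  have W: "density_op d W" unfolding W_def using u \<tau> by (intro density_eigmat) (auto simp: p_def)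
  have diff: "frob d X V - frob d W V = (\<Sum>i<d. (a i - p i) * qform d V (u i))" for V
  proof -
    have "frob d X V = frob d V (eigmat d a u)"
      using frob_cong[of d X "eigmat d a u" V V, OF a refl] by (simp add: frob_commute)
    then show ?thesis
      by (simp add: W_def frob_commute[of d "eigmat d p u"] frob_eigmat left_diff_distrib sum_subtractf)
  qed
  \<comment> \<open>The difference \<open>a i - p i\<close> is the minimum of \<open>a i\<close> and
    \<open>\<tau>\<close>. It never exceeds \<open>\<tau>\<close> and equals it wherever
    \<open>p i\<close> is nonzero, which gives equality for \<open>W\<close> below.\<close>
  have "frob d X V - frob d W V \<le> \<tau>" if "density_op d V" for V
  proof -
    have "frob d X V - frob d W V \<le> (\<Sum>i<d. \<tau> * qform d V (u i))"
      unfolding diff using density_weights(1)[OF that u]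
      by (intro sum_mono mult_right_mono) (auto simp: p_def)
    also have "\<dots> = \<tau>" using density_weights(2)[OF that u] by (simp flip: sum_distrib_left)
    finally show ?thesis .
  qed
  moreover have "frob d X W - frob d W W = \<tau>"
  proof -
    have "frob d X W - frob d W W = (\<Sum>i<d. (a i - p i) * p i)"
      unfolding diff by (simp add: W_def qform_eigmat_eigenvector[OF u])
    also have "\<dots> = (\<Sum>i<d. \<tau> * p i)"
      by (intro sum.cong refl) (auto simp: p_def max_def)
    also have "\<dots> = \<tau>" using \<tau> by (simp add: p_def flip: sum_distrib_left)
    finally show ?thesis .
  qed
  ultimately show ?thesis using W by auto
qed

lemma frob_add_right: "frob d A (\<lambda>k l. B k l + of_real s * C k l) = frob d A B + s * frob d A C"
  by (simp only: frob_commute[of d A] frob_add_left)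

lemma frob_nonneg: "0 \<le> frob d A A"
  by (simp add: frob_self sum_nonneg)

lemma frob_young: "2 * frob d A B \<le> frob d A A + frob d B B"
  using frob_nonneg[of d "\<lambda>k l. A k l + of_real (- 1) * B k l"]
  unfolding frob_add_left frob_add_right frob_commute[of d B A] by simp

text \<open>The potential is the maximum over states \<open>W\<close> of
  \<open>frob X W - frob W W / 2\<close>, attained at the projection. Its second order error is half
  the squared Frobenius norm of the increment, which the rank controls.\<close>

lemma frobenius_strategy:
  assumes "\<eta> > 0" "L \<ge> 0"
  shows "\<exists>S. is_learner n S \<and> (\<forall>A. (\<forall>(\<omega>, m) \<in> set (play S A T). admissible_move n r L m) \<longrightarrow>
    regret n (play S A T) \<le> (1 / 2 + real T * ((\<eta> * L)\<^sup>2 * real r / 2)) / \<eta>)"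
proof -
  let ?d = "2 ^ n :: nat"
  define Q where "Q X W \<longleftrightarrow> (\<forall>V. density_op ?d V \<longrightarrow> frob ?d X V - frob ?d W V \<le> frob ?d X W - frob ?d W W)" for X W
  have Q_cong: "Q X W'" if "Q X W" "\<And>k l. k < ?d \<Longrightarrow> l < ?d \<Longrightarrow> W' k l = W k l" for X W W'
  proof -
    have "frob ?d W' V = frob ?d W V" "frob ?d V W' = frob ?d V W" for V
      using that(2) by (auto intro: frob_cong)
    with that(1) show ?thesis by (simp add: Q_def)
  qed
  have Q_ex: "\<exists>W. density_op ?d W \<and> Q X W" if "herm ?d X" for X
    unfolding Q_def using that by (rule exists_density_projection) simp
  obtain P where P: "\<And>X. P X \<in> qstates n" and PQ: "\<And>X. herm ?d X \<Longrightarrow> Q X (entries (P X))"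
  proof -
    have "\<exists>P. (\<forall>X. P X \<in> qstates n) \<and> (\<forall>X. herm ?d X \<longrightarrow> Q X (entries (P X)))"
    proof (rule exists_density_choice)
      show "\<exists>W. density_op ?d W \<and> Q X W" if "herm ?d X" for X
        using that by (rule Q_ex)
      show "Q X W'" if "Q X W" "\<And>k l. k < ?d \<Longrightarrow> l < ?d \<Longrightarrow> W' k l = W k l" for X W W'
        using that by (rule Q_cong)
    qed
    then show ?thesis using that by blast
  qed
  define p where "p X = entries (P X)" for X
  have dens: "density_op ?d (p X)" for X unfolding p_def by (intro density_qstates P)
  have opt: "frob ?d X V - frob ?d (p X) V \<le> frob ?d X (p X) - frob ?d (p X) (p X)"
    if "herm ?d X" "density_op ?d V" for X V
    using PQ[OF that(1)] that(2) by (simp add: Q_def p_def)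
  define \<Phi> where "\<Phi> X = frob ?d X (p X) - frob ?d (p X) (p X) / 2" for X
  have "\<exists>S. is_learner n S \<and> (\<forall>A. (\<forall>(\<omega>, m) \<in> set (play S A T). admissible_move n r L m) \<longrightarrow>
    regret n (play S A T) \<le> (\<Phi> (\<lambda>_ _. 0) + 1 / 2 + real T * ((\<eta> * L)\<^sup>2 * real r / 2)) / \<eta>)"
  proof (rule potential_strategy[where P = P])
    fix X E s
    assume X: "herm ?d X" and E: "E \<in> effects n" "mat_rank ?d E \<le> r" and s: "\<bar>s\<bar> \<le> \<eta> * L"
    define X' where "X' = (\<lambda>k l. X k l + of_real s * entries E k l)"
    let ?F = "frob ?d"
    have out: "outcome E (P X) = ?F (entries E) (p X)"
      unfolding p_def by (rule outcome_effect_eq_frob[OF E(1) P])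
    \<comment> \<open>Optimality of the old projection is tested at the new one.\<close>
    have 1: "?F X (p X') - ?F (p X) (p X') \<le> ?F X (p X) - ?F (p X) (p X)"
      by (rule opt[OF X dens])
    have 2: "?F X' (p X') = ?F X (p X') + s * ?F (entries E) (p X')"
      unfolding X'_def by (rule frob_add_left)
    \<comment> \<open>This is the squared norm of \<open>p X - p X' + s E\<close>, expanded. It
      absorbs the distance between the two projections and leaves the squared norm of
      \<open>s E\<close>.\<close>
    have 3: "0 \<le> s * (s * ?F (entries E) (entries E)) + ?F (p X) (p X) + ?F (p X') (p X')
        + 2 * s * ?F (entries E) (p X) - 2 * s * ?F (entries E) (p X') - 2 * ?F (p X) (p X')"
      using frob_nonneg[of ?d "\<lambda>k l. (p X k l + of_real (- 1) * p X' k l) + of_real s * entries E k l"]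
      unfolding frob_add_left frob_add_right frob_commute[of ?d "p X'" "p X"]
        frob_commute[of ?d "p X" "entries E"] frob_commute[of ?d "p X'" "entries E"]
      by (simp add: algebra_simps)
    have "s * (s * ?F (entries E) (entries E)) = s\<^sup>2 * ?F (entries E) (entries E)"
      by (simp add: power2_eq_square)
    also have "\<dots> \<le> (\<eta> * L)\<^sup>2 * real r"
    proof (rule mult_mono)
      show "s\<^sup>2 \<le> (\<eta> * L)\<^sup>2" using s by (simp add: abs_le_square_iff[symmetric])
      show "?F (entries E) (entries E) \<le> real r" using effect_frob_le_rank[OF E(1)] E(2) by linarith
    qed (auto simp: frob_nonneg)
    finally show "\<Phi> (\<lambda>k l. X k l + of_real s * entries E k l)
        \<le> \<Phi> X + s * outcome E (P X) + (\<eta> * L)\<^sup>2 * real r / 2"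
      using 1 2 3 unfolding out \<Phi>_def X'_def[symmetric] by (simp add: algebra_simps)
  next
    fix X \<sigma> assume X: "herm ?d X" and \<sigma>: "\<sigma> \<in> qstates n"
    show "frob ?d X (entries \<sigma>) \<le> \<Phi> X + 1 / 2"
      \<comment> \<open>The optimality inequality leaves the product of \<open>p X\<close> and
        \<open>\<sigma>\<close>, which Young's inequality splits; the offset 1/2 is half the bound
        on the squared norm of a state.\<close>
      using opt[OF X density_qstates[OF \<sigma>]] frob_young[of ?d "p X" "entries \<sigma>"]
        frob_density_le_1[OF density_qstates[OF \<sigma>]]
      by (simp add: \<Phi>_def)
  qed (use assms P in auto)
  moreover have "\<Phi> (\<lambda>_ _. 0) \<le> 0"
    unfolding \<Phi>_def using frob_nonneg[of ?d "p (\<lambda>_ _. 0)"] by (simp add: frob_def)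
  then have "(\<Phi> (\<lambda>_ _. 0) + 1 / 2 + real T * ((\<eta> * L)\<^sup>2 * real r / 2)) / \<eta>
      \<le> (1 / 2 + real T * ((\<eta> * L)\<^sup>2 * real r / 2)) / \<eta>"
    using assms(1) by (intro divide_right_mono) auto
  ultimately show ?thesis by (meson order_trans)
qed

section \<open>Gibbs states and the dimension-dependent bound\<close>

lemma matvec_scale: "matvec d (\<lambda>k l. c * A k l) x k = c * matvec d A x k"
  by (simp add: matvec_def sum_distrib_left mult.assoc)

lemma frob_scale_left: "frob d (\<lambda>k l. of_real s * A k l) B = s * frob d A B"
  by (simp add: frob_def sum_distrib_left sum.distrib distrib_left mult.assoc)

text \<open>The second order term uses only that effects are contractions, so the rank disappears.
  The condition on \<open>\<eta> * L\<close> keeps the relative error small enough to be moved into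
  an exponential.\<close>

lemma entropic_strategy:
  assumes "\<eta> > 0" "L \<ge> 0" "(\<eta> * L)\<^sup>2 \<le> 1 / 2"
  shows "\<exists>S. is_learner n S \<and> (\<forall>A. (\<forall>(\<omega>, m) \<in> set (play S A T). admissible_move n r L m) \<longrightarrow>
    regret n (play S A T) \<le> (real n + real T * (3 * (\<eta> * L)\<^sup>2)) / \<eta>)"
proof -
  let ?d = "2 ^ n :: nat"
  define eig where "eig X a u \<longleftrightarrow> orthon ?d ?d u \<and> (\<forall>k<?d. \<forall>l<?d. X k l = eigmat ?d a u k l)" for X a u
  \<comment> \<open>One eigendecomposition is fixed for every Hermitian \<open>X\<close>, so that
    the partition function \<open>Z\<close> becomes a function of \<open>X\<close>.\<close>
  obtain a u where eig: "eig X (a X) (u X)" if "herm ?d X" for X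
  proof -
    have "\<exists>au. herm ?d X \<longrightarrow> eig X (fst au) (snd au)" for X
    proof (cases "herm ?d X")
      case True
      then obtain v b where "orthon ?d ?d v" "\<And>k l. k < ?d \<Longrightarrow> l < ?d \<Longrightarrow> X k l = eigmat ?d b v k l"
        using spectral_theorem by blast
      then have "eig X (fst (b, v)) (snd (b, v))" by (simp add: eig_def)
      then show ?thesis by blast
    qed simp
    then obtain f where "\<And>X. herm ?d X \<Longrightarrow> eig X (fst (f X)) (snd (f X))" by metis
    then show ?thesis using that[of "\<lambda>X. fst (f X)" "\<lambda>X. snd (f X)"] by blast
  qed
  have u: "orthon ?d ?d (u X)" if "herm ?d X" for X using eig[OF that] by (simp add: eig_def)
  have a: "X k l = eigmat ?d (a X) (u X) k l" if "herm ?d X" "k < ?d" "l < ?d" for X k l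
    using eig[OF that(1)] that(2,3) by (simp add: eig_def)
  define Z where "Z X = (\<Sum>i<?d. exp (a X i))" for X
  have Z: "Z X > 0" for X unfolding Z_def by (intro sum_pos) (auto simp: lessThan_empty_iff)
  \<comment> \<open>This characterises the Gibbs state by its pairings with all matrices, cleared of
    the denominator \<open>Z X\<close>.\<close>
  define Q where "Q X W \<longleftrightarrow> (\<forall>M. Z X * frob ?d M W = frob ?d M (eigmat ?d (\<lambda>i. exp (a X i)) (u X)))" for X W
  have Q_cong: "Q X W'" if "Q X W" "\<And>k l. k < ?d \<Longrightarrow> l < ?d \<Longrightarrow> W' k l = W k l" for X W W'
  proof -
    have "frob ?d M W' = frob ?d M W" for M using that(2) by (auto intro: frob_cong)
    with that(1) show ?thesis by (simp add: Q_def)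
  qed
  have Q_ex: "\<exists>W. density_op ?d W \<and> Q X W" if "herm ?d X" for X
  proof (intro exI conjI)
    show "density_op ?d (eigmat ?d (\<lambda>i. exp (a X i) / Z X) (u X))"
      using Z[of X] by (intro density_eigmat u that) (auto simp: Z_def simp flip: sum_divide_distrib)
    show "Q X (eigmat ?d (\<lambda>i. exp (a X i) / Z X) (u X))"
      using Z[of X] by (simp add: Q_def frob_eigmat flip: sum_divide_distrib)
  qed
  obtain P where P: "\<And>X. P X \<in> qstates n" and PQ: "\<And>X. herm ?d X \<Longrightarrow> Q X (entries (P X))"
  proof -
    have "\<exists>P. (\<forall>X. P X \<in> qstates n) \<and> (\<forall>X. herm ?d X \<longrightarrow> Q X (entries (P X)))"
    proof (rule exists_density_choice)
      show "\<exists>W. density_op ?d W \<and> Q X W" if "herm ?d X" for X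
        using that by (rule Q_ex)
      show "Q X W'" if "Q X W" "\<And>k l. k < ?d \<Longrightarrow> l < ?d \<Longrightarrow> W' k l = W k l" for X W W'
        using that by (rule Q_cong)
    qed
    then show ?thesis using that by blast
  qed
  define \<delta> where "\<delta> = (\<eta> * L)\<^sup>2"
  have \<delta>: "0 \<le> \<delta>" "\<delta> \<le> 1 / 2" using assms by (auto simp: \<delta>_def)
  have "\<exists>S. is_learner n S \<and> (\<forall>A. (\<forall>(\<omega>, m) \<in> set (play S A T). admissible_move n r L m) \<longrightarrow>
    regret n (play S A T) \<le> (ln (Z (\<lambda>_ _. 0)) + 0 + real T * (3 * \<delta>)) / \<eta>)"
  proof (rule potential_strategy[where P = P])
    fix X E s
    assume X: "herm ?d X" and E: "E \<in> effects n" "mat_rank ?d E \<le> r" and s: "\<bar>s\<bar> \<le> \<eta> * L"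
    define X' where "X' = (\<lambda>k l. X k l + of_real s * entries E k l)"
    have X': "herm ?d X'" unfolding X'_def by (intro herm_add X effect_herm E)
    define x where "x = s * outcome E (P X)"
    have "Z X' - Z X - frob ?d (\<lambda>k l. of_real s * entries E k l) (eigmat ?d (\<lambda>i. exp (a X i)) (u X))
        \<le> \<delta> * (Z X' + Z X)"
      unfolding Z_def
    proof (rule trace_exp_perturbation[OF u[OF X'] u[OF X]])
      fix k l assume "k < ?d" "l < ?d"
      then show "eigmat ?d (a X') (u X') k l = eigmat ?d (a X) (u X) k l + of_real s * entries E k l"
        using a[OF X, of k l] a[OF X', of k l] by (simp add: X'_def)
    next
      fix y :: "nat \<Rightarrow> complex"
      have "(\<Sum>k<?d. (cmod (matvec ?d (\<lambda>k l. of_real s * entries E k l) y k))\<^sup>2)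
          = s\<^sup>2 * (\<Sum>k<?d. (cmod (matvec ?d (entries E) y k))\<^sup>2)"
        by (simp add: matvec_scale norm_mult power_mult_distrib sum_distrib_left)
      also have "\<dots> \<le> \<delta> * (\<Sum>k<?d. (cmod (y k))\<^sup>2)"
      proof (rule mult_mono)
        show "s\<^sup>2 \<le> \<delta>" using s by (simp add: \<delta>_def abs_le_square_iff[symmetric])
      qed (auto simp: effect_contraction E \<delta> intro: sum_nonneg)
      finally show "(\<Sum>k<?d. (cmod (matvec ?d (\<lambda>k l. of_real s * entries E k l) y k))\<^sup>2)
          \<le> \<delta> * (\<Sum>k<?d. (cmod (y k))\<^sup>2)" .
    qed
    also have "frob ?d (\<lambda>k l. of_real s * entries E k l) (eigmat ?d (\<lambda>i. exp (a X i)) (u X)) = Z X * x"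
      using PQ[OF X] by (simp add: frob_scale_left Q_def x_def outcome_effect_eq_frob[OF E(1) P] mult_ac)
    finally have "Z X' * (1 - \<delta>) \<le> Z X * (1 + \<delta> + x)" by (simp add: algebra_simps)
    \<comment> \<open>Multiplying by \<open>1 + 2 * \<delta>\<close> removes the factor
      \<open>1 - \<delta>\<close>, as \<open>\<delta>\<close> is at most 1/2. Of the final
      \<open>3 * \<delta>\<close>, two parts come from here and one from the perturbation
      bound.\<close>
    have "Z X' * 1 \<le> Z X' * ((1 - \<delta>) * (1 + 2 * \<delta>))"
    proof (rule mult_left_mono)
      have "0 \<le> \<delta> * (1 - 2 * \<delta>)" using \<delta> by (intro mult_nonneg_nonneg) auto
      then show "1 \<le> (1 - \<delta>) * (1 + 2 * \<delta>)" by (simp add: algebra_simps)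
    qed (use Z[of X'] in simp)
    also have "\<dots> = Z X' * (1 - \<delta>) * (1 + 2 * \<delta>)" by simp
    also have "\<dots> \<le> Z X * (1 + \<delta> + x) * (1 + 2 * \<delta>)"
      using \<open>Z X' * (1 - \<delta>) \<le> _\<close> \<delta> by (intro mult_right_mono) auto
    also have "\<dots> \<le> Z X * exp (\<delta> + x) * (1 + 2 * \<delta>)"
    proof (intro mult_right_mono mult_left_mono)
      show "1 + \<delta> + x \<le> exp (\<delta> + x)" using exp_ge_add_one_self[of "\<delta> + x"] by linarith
    qed (use Z[of X] \<delta> in auto)
    also have "\<dots> \<le> Z X * exp (\<delta> + x) * exp (2 * \<delta>)"
      using Z[of X] exp_ge_add_one_self[of "2 * \<delta>"] by (intro mult_left_mono) auto
    also have "\<dots> = Z X * exp (x + 3 * \<delta>)" by (simp add: mult.assoc algebra_simps flip: exp_add)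
    finally have "ln (Z X') \<le> ln (Z X * exp (x + 3 * \<delta>))"
      using Z[of X] Z[of X'] by simp
    also have "\<dots> = ln (Z X) + (x + 3 * \<delta>)" using Z[of X] by (simp add: ln_mult)
    finally show "ln (Z (\<lambda>k l. X k l + of_real s * entries E k l)) \<le> ln (Z X) + s * outcome E (P X) + 3 * \<delta>"
      by (simp add: X'_def x_def)
  next
    fix X \<sigma> assume X: "herm ?d X" and \<sigma>: "\<sigma> \<in> qstates n"
    note W = density_weights[OF density_qstates[OF \<sigma>] u[OF X]]
    have le: "a X i \<le> ln (Z X)" if "i < ?d" for i
    proof -
      have "exp (a X i) \<le> Z X" 
        unfolding Z_def using that by (intro member_le_sum[of i "{..<?d}" "\<lambda>i. exp (a X i)"]) auto
      then show ?thesis using Z[of X] by (simp add: ln_ge_iff)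
    qed
    have "frob ?d X (entries \<sigma>) = frob ?d (entries \<sigma>) (eigmat ?d (a X) (u X))"
      using frob_cong[of ?d X "eigmat ?d (a X) (u X)" "entries \<sigma>" "entries \<sigma>", OF a[OF X] refl]
      by (simp add: frob_commute)
    also have "\<dots> = (\<Sum>i<?d. a X i * qform ?d (entries \<sigma>) (u X i))" by (rule frob_eigmat)
    also have "\<dots> \<le> (\<Sum>i<?d. ln (Z X) * qform ?d (entries \<sigma>) (u X i))"
      using le W(1) by (intro sum_mono mult_right_mono) auto
    also have "\<dots> = ln (Z X) + 0" using W(2) by (simp flip: sum_distrib_left)
    finally show "frob ?d X (entries \<sigma>) \<le> ln (Z X) + 0" .
  qed (use assms P in auto)
  moreover have "ln (Z (\<lambda>_ _. 0)) \<le> real n"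
  proof -
    have 0: "herm ?d (\<lambda>_ _. 0)" by (simp add: herm_def)
    \<comment> \<open>The decomposition was chosen arbitrarily, so the eigenvalues of the zero
      matrix are recovered as values of its quadratic form.\<close>
    have "a (\<lambda>_ _. 0) i = 0" if "i < ?d" for i
    proof -
      have "a (\<lambda>_ _. 0) i = qform ?d (eigmat ?d (a (\<lambda>_ _. 0)) (u (\<lambda>_ _. 0))) (u (\<lambda>_ _. 0) i)"
        by (rule qform_eigmat_eigenvector[OF u[OF 0] that, symmetric])
      also have "\<dots> = qform ?d (\<lambda>_ _. 0) (u (\<lambda>_ _. 0) i)"
        by (rule qform_cong) (rule a[OF 0, symmetric])
      finally show ?thesis by (simp add: qform_def matvec_def dotc_def)
    qed
    then have "Z (\<lambda>_ _. 0) = 2 ^ n" by (simp add: Z_def)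
    then have "ln (Z (\<lambda>_ _. 0)) = real n * ln 2" by (simp add: ln_realpow)
    also have "\<dots> \<le> real n * 1" using ln_2_less_1 by (intro mult_left_mono) auto
    finally show ?thesis by simp
  qed
  then have "(ln (Z (\<lambda>_ _. 0)) + 0 + real T * (3 * \<delta>)) / \<eta> \<le> (real n + real T * (3 * (\<eta> * L)\<^sup>2)) / \<eta>"
    using assms(1) by (intro divide_right_mono) (auto simp: \<delta>_def)
  ultimately show ?thesis by (meson order_trans)
qed

section \<open>Choice of the learning rate in the three regimes\<close>

theorem corollary2p3:
  shows "\<exists>C::real. C > 0 \<and>
    (\<forall>(n::nat) (T::nat) (r::nat) (L::real). n \<ge> 1 \<longrightarrow> T \<ge> 1 \<longrightarrow> r \<ge> 1 \<longrightarrow> L > 0 \<longrightarrow>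
      (\<exists>S::learner. is_learner n S \<and>
        (\<forall>A::adversary.
          (\<forall>(\<omega>, m) \<in> set (play S A T). admissible_move n r L m) \<longrightarrow>
          regret n (play S A T) \<le> C * L * sqrt (real (min r n) * real T))))"
\<comment> \<open>The factors in the three regimes are 1, 7/2 and 1; 4 covers all of them.\<close>
proof (intro exI[of _ 4] conjI allI impI)
  fix n T r :: nat and L :: real
  assume n: "n \<ge> 1" and T: "T \<ge> 1" and r: "r \<ge> 1" and L: "L > 0"
  show "\<exists>S::learner. is_learner n S \<and>
        (\<forall>A::adversary.
          (\<forall>(\<omega>, m) \<in> set (play S A T). admissible_move n r L m) \<longrightarrow>
          regret n (play S A T) \<le> 4 * L * sqrt (real (min r n) * real T))" (is ?thesis)
  proof -
    have main: ?thesis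
      if "B \<le> 4 * L * sqrt (real (min r n) * real T)"
        and "\<exists>S. is_learner n S \<and> (\<forall>A. (\<forall>(\<omega>, m) \<in> set (play S A T). admissible_move n r L m) \<longrightarrow>
          regret n (play S A T) \<le> B)" for B
      using that by (meson order_trans)
    consider "r \<le> n" | "n \<le> r" "n \<le> T" | "n \<le> r" "T \<le> n" by linarith
    then show ?thesis
    proof cases
      case 1
      define w where "w = sqrt (real r * real T)"
      have w: "w > 0" "w\<^sup>2 = real r * real T" using r T by (simp_all add: w_def)
      \<comment> \<open>This rate balances \<open>1 / (2 * \<eta>)\<close> against the accumulated
        second order term; each contributes half of \<open>L * w\<close>.\<close>
      define \<eta> where "\<eta> = 1 / (L * w)"
      have "(1 / 2 + real T * ((\<eta> * L)\<^sup>2 * real r / 2)) / \<eta> = (1 / 2 + (real r * real T) / w\<^sup>2 / 2) * (L * w)"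
        using w(1) L by (simp add: \<eta>_def power_divide)
      also have "\<dots> = L * w" using w r T by simp
      finally have "(1 / 2 + real T * ((\<eta> * L)\<^sup>2 * real r / 2)) / \<eta> \<le> 4 * L * sqrt (real (min r n) * real T)"
        using 1 L w by (simp add: w_def min_def)
      moreover have "\<eta> > 0" using w L by (simp add: \<eta>_def)
      note frobenius_strategy[OF this less_imp_le[OF L], of n T r]
      ultimately show ?thesis by (rule main)
    next
      case 2
      define w where "w = sqrt (real n * real T)"
      have w: "w > 0" "w\<^sup>2 = real n * real T" using n T by (simp_all add: w_def)
      \<comment> \<open>With this rate \<open>(\<eta> * L)\<^sup>2\<close> is
        \<open>n / (4 * T)\<close>, at most 1/4 because \<open>n \<le> T\<close>. The two terms
        become \<open>2 * L * w\<close> and \<open>3 / 2 * L * w\<close>.\<close>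
      define \<eta> where "\<eta> = real n / (2 * L * w)"
      have \<eta>L: "(\<eta> * L)\<^sup>2 = real n / (4 * real T)"
      proof -
        have "(\<eta> * L)\<^sup>2 = (real n)\<^sup>2 / (4 * w\<^sup>2)"
          using L w(1) by (simp add: \<eta>_def power_divide power_mult_distrib)
        then show ?thesis using n T w(2) by (simp add: power2_eq_square)
      qed
      have "(real n + real T * (3 * (\<eta> * L)\<^sup>2)) / \<eta> = 7 / 2 * L * w"
        unfolding \<eta>L using n T L w(1) by (simp add: \<eta>_def field_simps)
      also have "\<dots> \<le> 4 * L * w" using L w(1) by simp
      also have "\<dots> = 4 * L * sqrt (real (min r n) * real T)"
        using 2 by (simp add: w_def min_absorb2)
      finally have "(real n + real T * (3 * (\<eta> * L)\<^sup>2)) / \<eta> \<le> 4 * L * sqrt (real (min r n) * real T)" .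
      moreover have "\<eta> > 0" "(\<eta> * L)\<^sup>2 \<le> 1 / 2"
        unfolding \<eta>L using w L n 2 T by (simp_all add: \<eta>_def divide_simps)
      note entropic_strategy[OF this(1) less_imp_le[OF L] this(2), of n T r]
      ultimately show ?thesis by (rule main)
    next
      case 3
      have "sqrt (real T * real T) \<le> sqrt (real n * real T)"
        using 3 by (intro real_sqrt_le_mono mult_right_mono) auto
      then have "real T \<le> sqrt (real (min r n) * real T)" using 3 by (simp add: min_def)
      then have "L * real T \<le> 4 * L * sqrt (real (min r n) * real T)"
        using L by (intro mult_mono) auto
      moreover note constant_strategy[OF less_imp_le[OF L], of n T r]
      ultimately show ?thesis by (rule main)
    qed
  qed
qed simp

end
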